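(* Let $d\ge1$ and let $B=(B_x)_{x\in\mathbb R^d}$ be a centered, stationary, jointly measurable Gaussian field with continuous covariance function $C$, i.e. $\mathbb E[B_xB_y]=C(x-y)$, with $C(0)=1$. Suppose there exist constants $C_1,C_2,C_3,\alpha,\delta,\epsilon>0$ such that $$|C(x)|\le C_1\|x\|^{-\delta}\ \ \forall x\in\mathbb R^d,\qquad C_2\|x\|^\alpha\le 1-C(x)\le C_3\|x\|^\alpha\ \ \text{for }\|x\|\le\epsilon.$$ Let $E\subseteq\mathbb R^d$ be a compact set with positive Lebesgue measure, $\mu$ Lebesgue measure on $E$, and $V(u)=\int_E\mathbf 1_{\{B_x\ge u\}}\,dx$. Then for every $u\in\mathbb R$ and $p\in\mathbb N$: $V(u)\in\mathbb D^{p,2}$ if and only if $p<d/\alpha+\tfrac12$.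
   Context: Hermite polynomials: $H_0=1$, $H_1(x)=x$, $H_{q+1}(x)=xH_q(x)-qH_{q-1}(x)$; $\phi(x)=e^{-x^2/2}/\sqrt{2\pi}$. For $\varphi\in L^2(\mathbb R,\phi(x)dx)$, $a_q(\varphi)=\frac1{q!}\int_{\mathbb R}H_q\varphi\phi\,dx$, and for the functional $Y(\varphi)=\int_E\varphi(B_x)\mu(dx)$ one says $Y(\varphi)\in\mathbb D^{p,2}$ iff $\sum_{q\ge0}q^p\,q!\,a_q(\varphi)^2\int_{E^2}K(x,y)^q\,\mu(dx)\mu(dy)<\infty$, where $K(x,y)=\mathbb E[B_xB_y]$. Here $V(u)=Y(\mathbf 1_{[u,\infty)})$. *)

theory Defs
  imports "HOL-Probability.Probability"
begin

fun hermite :: "nat \<Rightarrow> real \<Rightarrow> real" where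
  "hermite 0 x = 1"
| "hermite (Suc 0) x = x"
| "hermite (Suc (Suc q)) x = x * hermite (Suc q) x - real (Suc q) * hermite q x"

definition hermite_coeff :: "nat \<Rightarrow> (real \<Rightarrow> real) \<Rightarrow> real" where
  "hermite_coeff q f = (1 / fact q) * (LINT x|lborel. hermite q x * f x * std_normal_density x)"

text \<open>Y(phi) = int_E phi(B_x) mu(dx) belongs to D^{p,2}, with covariance kernel K.\<close>
definition in_D_p2 :: "nat \<Rightarrow> ('x \<Rightarrow> 'x \<Rightarrow> real) \<Rightarrow> 'x measure \<Rightarrow> (real \<Rightarrow> real) \<Rightarrow> bool" where
  "in_D_p2 p K \<mu> f \<longleftrightarrow>
     summable (\<lambda>q. real q ^ p * fact q * (hermite_coeff q f)\<^sup>2 *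
                   (\<integral>z. K (fst z) (snd z) ^ q \<partial>(\<mu> \<Otimes>\<^sub>M \<mu>)))"

definition gaussian_rv :: "'a measure \<Rightarrow> ('a \<Rightarrow> real) \<Rightarrow> bool" where
  "gaussian_rv M X \<longleftrightarrow>
     (\<exists>m \<sigma>. (\<sigma> > 0 \<and> distributed M lborel X (normal_density m \<sigma>))
           \<or> (X \<in> borel_measurable M \<and> (AE \<omega> in M. X \<omega> = m)))"

definition centered_stationary_gaussian_field ::
  "'a measure \<Rightarrow> (real^'n \<Rightarrow> 'a \<Rightarrow> real) \<Rightarrow> (real^'n \<Rightarrow> real) \<Rightarrow> bool" where
  "centered_stationary_gaussian_field M B C \<longleftrightarrow>
     prob_space M
   \<and> (\<lambda>(x, \<omega>). B x \<omega>) \<in> borel_measurable (lborel \<Otimes>\<^sub>M M)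
   \<and> (\<forall>xs cs. length cs = length xs \<longrightarrow>
          gaussian_rv M (\<lambda>\<omega>. \<Sum>i<length xs. cs ! i * B (xs ! i) \<omega>))
   \<and> (\<forall>x. integrable M (B x) \<and> (\<integral>\<omega>. B x \<omega> \<partial>M) = 0)
   \<and> (\<forall>x y. integrable M (\<lambda>\<omega>. B x \<omega> * B y \<omega>) \<and>
            (\<integral>\<omega>. B x \<omega> * B y \<omega> \<partial>M) = C (x - y))"

end

(*
For q >= 1 the Hermite coefficient of the indicator of [u, oo) is H_{q-1}(u) phi(u) / q!, so the
series has the terms phi(u)^2 q^{p-1} w_{q-1} I_q with w_n = H_n(u)^2 / n! and
I_q = the integral over E x E of C(x-y)^q.

I_q is comparable to q^{-d/alpha}: stationarity and decay force |C| < 1 off the origin, hence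
|C(z)| <= 1 - c |z|^alpha on the bounded set E - E, and rescaling exp(-c q |z|^alpha) gives the
upper bound; the lower bound comes from the pairs with |x-y| of order q^{-1/alpha}, since
E and E + z overlap substantially for small z.

By the Christoffel-Darboux formula, m (w_m + w_{m-1}) agrees with w_0 + ... + w_{m-1} up to a
relative error O(m^{-1/2}).  This is a discrete differential equation S' = S / (2m) with summable
perturbation for the partial sums, so S_m is comparable to m^{1/2} and w_m + w_{m-1} to m^{-1/2}.
The series thus behaves like the sum of q^{p - 3/2 - d/alpha}.  A single w_m can be small, which
is why the divergence part pairs consecutive terms.
*)
theory Submission
  imports Defs "HOL-Real_Asymp.Real_Asymp"
begin

section \<open>Growth of Hermite polynomials at a fixed point\<close>

text \<open>The confluent kernel (H_{n+1}' H_n - H_{n+1} H_n') / n!, with both derivatives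
  eliminated through H_q' = q H_{q-1} and the recurrence. Only H_{n+1} and H_n are left, so the
  induction needs nothing but the recurrence.\<close>

lemma hermite_christoffel_darboux:
  "(\<Sum>k\<le>n. (hermite k x)\<^sup>2 / fact k) =
     ((hermite (Suc n) x)\<^sup>2 - x * hermite (Suc n) x * hermite n x
       + real (Suc n) * (hermite n x)\<^sup>2) / fact n"
proof (induction n)
  case 0
  show ?case by (simp add: power2_eq_square)
next
  case (Suc n)
  let ?H = "hermite (Suc (Suc n)) x" and ?h = "hermite (Suc n) x" and ?g = "hermite n x"
  have "(?h\<^sup>2 - x * ?h * ?g + real (Suc n) * ?g\<^sup>2) / fact n
      = (real (Suc n) * (?h\<^sup>2 - x * ?h * ?g + real (Suc n) * ?g\<^sup>2)) / fact (Suc n)"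
    unfolding fact_Suc of_nat_mult by (subst mult_divide_mult_cancel_left) auto
  moreover have "real (Suc n) * (?h\<^sup>2 - x * ?h * ?g + real (Suc n) * ?g\<^sup>2) + ?h\<^sup>2
      = ?H\<^sup>2 - x * ?H * ?h + real (Suc (Suc n)) * ?h\<^sup>2"
    unfolding hermite.simps(3) by (simp add: algebra_simps power2_eq_square)
  ultimately show ?case
    unfolding sum.atMost_Suc Suc.IH by (simp add: add_divide_distrib[symmetric] del: fact_Suc hermite.simps)
qed

section \<open>Growth of sequences with controlled increments\<close>

lemma bounded_if_summable_increments:
  fixes L :: "nat \<Rightarrow> real"
  assumes inc: "\<And>n. n \<ge> N \<Longrightarrow> \<bar>L (Suc n) - L n\<bar> \<le> g n" and g: "summable g"
  shows "\<exists>K. \<forall>n\<ge>N. \<bar>L n\<bar> \<le> K"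
proof -
  have "summable (\<lambda>n. L (Suc n) - L n)"
    by (rule summable_comparison_test'[OF g, of N]) (simp add: inc)
  then have "convergent (\<lambda>n. \<Sum>k<n. L (Suc k) - L k)"
    by (simp add: summable_iff_convergent)
  then have "convergent (\<lambda>n. L n - L 0)"
    by (simp add: sum_lessThan_telescope)
  then have "Bseq (\<lambda>n. L n - L 0)"
    by (rule convergent_imp_Bseq)
  then obtain K where K: "\<And>n. norm (L n - L 0) \<le> K"
    unfolding Bseq_def by blast
  show ?thesis
  proof (intro exI[of _ "K + \<bar>L 0\<bar>"] allI impI)
    fix n show "\<bar>L n\<bar> \<le> K + \<bar>L 0\<bar>" using K[of n] by simp
  qed
qed

text \<open>The hypothesis is a discrete form of D' = D / (2 n) with a summable relative error.
  Hence ln D - (ln n) / 2 has absolutely summable increments and stays bounded, and exponentiating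
  the bound gives the two constants.\<close>

lemma sqrt_growth_from_increments:
  fixes D :: "nat \<Rightarrow> real"
  assumes D: "\<And>n. D n > 0"
    and inc: "\<And>n. n \<ge> N \<Longrightarrow> \<bar>D (Suc n) - D n - D (Suc n) / (2 * real (Suc n))\<bar>
                \<le> K * D (Suc n) * real (Suc n) powr (- 3 / 2)"
  shows "\<exists>a b N. 0 < a \<and> 0 < b \<and> (\<forall>n\<ge>N. a * sqrt n \<le> D n \<and> D n \<le> b * sqrt n)"
proof -
  \<comment> \<open>The relative backward increment: the ratio of consecutive values is 1 -
    \<open>e n\<close>, and dividing the hypothesis by \<open>D (Suc n)\<close> shows that
    \<open>e n\<close> is 1 / (2 (n+1)) up to order n^{-3/2}.\<close>
  define e where "e n = 1 - D n / D (Suc n)" for n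
  have e: "\<bar>e n - 1 / (2 * real (Suc n))\<bar> \<le> K * real (Suc n) powr (- 3 / 2)" if "n \<ge> N" for n
  proof -
    have "e n - 1 / (2 * real (Suc n)) =
        (D (Suc n) - D n - D (Suc n) / (2 * real (Suc n))) / D (Suc n)"
      using D[of "Suc n"] unfolding e_def by (simp add: field_simps)
    also have "\<bar>\<dots>\<bar> = \<bar>D (Suc n) - D n - D (Suc n) / (2 * real (Suc n))\<bar> / D (Suc n)"
      using D[of "Suc n"] by simp
    also have "\<dots> \<le> K * D (Suc n) * real (Suc n) powr (- 3 / 2) / D (Suc n)"
      using D[of "Suc n"] by (intro divide_right_mono inc that) simp
    also have "\<dots> = K * real (Suc n) powr (- 3 / 2)"
      using D[of "Suc n"] by simp
    finally show ?thesis .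
  qed
  \<comment> \<open>The sign of \<open>K\<close> is not known; the estimates that multiply by it use
    a nonnegative majorant.\<close>
  define k where "k = max K 0"
  have k: "0 \<le> k" "K \<le> k" unfolding k_def by auto
  have pw: "real (Suc n) powr (- 3 / 2) \<le> 1 / real (Suc n)" for n
  proof -
    have "real (Suc n) powr (- 3 / 2) \<le> real (Suc n) powr (- 1)"
      by (intro powr_mono) auto
    then show ?thesis by (simp add: powr_minus_divide)
  qed
  have pw2: "1 / (real (Suc n))\<^sup>2 \<le> real (Suc n) powr (- 3 / 2)" for n
  proof -
    have "real (Suc n) powr (- 2) \<le> real (Suc n) powr (- 3 / 2)"
      by (intro powr_mono) auto
    then show ?thesis by (simp add: powr_minus_divide powr_numeral)
  qed
  have e': "\<bar>e n\<bar> \<le> (1 + k) / real (Suc n)" if "n \<ge> N" for n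
  proof -
    have "\<bar>e n\<bar> \<le> 1 / (2 * real (Suc n)) + K * real (Suc n) powr (- 3 / 2)"
    proof -
      have "0 \<le> 1 / (2 * real (Suc n))" by simp
      then show ?thesis using e[OF that] by linarith
    qed
    also have "\<dots> \<le> 1 / real (Suc n) + k * (1 / real (Suc n))"
      using k by (intro add_mono mult_mono pw) (auto simp: field_simps)
    finally show ?thesis by (simp add: field_simps)
  qed
  \<comment> \<open>Beyond \<open>N1\<close> the increment \<open>e n\<close> is at most 1/2 in
    absolute value, as the quadratic bound for ln (1 + x) requires. The 1 in \<open>N2\<close>
    serves the same bound at 1 / (n+1) and keeps ln n meaningful.\<close>
  obtain N1 where N1: "real N1 \<ge> 2 * (1 + k)" using real_arch_simple by blast
  define N2 where "N2 = max N (max N1 1)"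
  define L where "L n = ln (D n) - ln (real n) / 2" for n
  have "\<bar>L (Suc n) - L n\<bar> \<le> (k + 2 * (1 + k)\<^sup>2 + 1) * real (Suc n) powr (- 3 / 2)"
    if n: "n \<ge> N2" for n
  proof -
    have nN: "n \<ge> N" "n \<ge> N1" "n \<ge> 1" using n unfolding N2_def by auto
    have "2 * (1 + k) \<le> real (Suc n)" using N1 nN(2) by simp
    then have "(1 + k) / real (Suc n) \<le> 1 / 2" using k by (simp add: field_simps)
    then have eh: "\<bar>- e n\<bar> \<le> 1 / 2" using e'[OF nN(1)] unfolding abs_minus_cancel by (rule order_trans[rotated])
    have l1: "\<bar>ln (1 + (- e n)) - (- e n)\<bar> \<le> 2 * (- e n)\<^sup>2"
      by (rule abs_ln_one_plus_x_minus_x_bound[OF eh])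
    have "(e n)\<^sup>2 \<le> ((1 + k) / real (Suc n))\<^sup>2"
      using e'[OF nN(1)] by (metis abs_ge_zero power2_abs power_mono)
    also have "\<dots> = (1 + k)\<^sup>2 * (1 / (real (Suc n))\<^sup>2)"
      by (simp add: power_divide)
    also have "\<dots> \<le> (1 + k)\<^sup>2 * real (Suc n) powr (- 3 / 2)"
      by (intro mult_left_mono pw2) simp
    finally have e2: "(e n)\<^sup>2 \<le> (1 + k)\<^sup>2 * real (Suc n) powr (- 3 / 2)" .
    have "\<bar>- (1 / real (Suc n))\<bar> \<le> 1 / 2" using nN(3) by (simp add: field_simps)
    from abs_ln_one_plus_x_minus_x_bound[OF this]
    have l2: "\<bar>ln (1 - 1 / real (Suc n)) + 1 / real (Suc n)\<bar> \<le> 2 * (1 / (real (Suc n))\<^sup>2)"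
      by (simp add: power_divide)
    have r1: "1 + (- e n) = D n / D (Suc n)" unfolding e_def by simp
    have r2: "1 - 1 / real (Suc n) = real n / real (Suc n)" by (simp add: field_simps)
    \<comment> \<open>The first-order parts of the two logarithms, \<open>e n\<close> and 1 / (2
      (n+1)), cancel up to order n^{-3/2}; the quadratic remainders are of order n^{-2}.\<close>
    have "L (Suc n) - L n = - ln (1 + (- e n)) + ln (1 - 1 / real (Suc n)) / 2"
      unfolding L_def r1 r2 using D[of n] D[of "Suc n"] nN(3)
      by (simp add: ln_div field_simps)
    also have "\<bar>\<dots>\<bar> \<le> \<bar>e n - 1 / (2 * real (Suc n))\<bar> + 2 * (e n)\<^sup>2 + 1 / (real (Suc n))\<^sup>2"
    proof -
      have "\<bar>- X + Y / 2\<bar> \<le> \<bar>z - r / 2\<bar> + 2 * y + t"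
        if "\<bar>X - (- z)\<bar> \<le> 2 * y" "\<bar>Y + r\<bar> \<le> 2 * t" for X Y r t y z :: real
        using that by linarith
      note this[OF l1 l2]
      moreover have "1 / (2 * real (Suc n)) = 1 / real (Suc n) / 2" by simp
      ultimately show ?thesis by (simp only: power2_minus)
    qed
    also have "\<dots> \<le> k * real (Suc n) powr (- 3 / 2)
        + 2 * ((1 + k)\<^sup>2 * real (Suc n) powr (- 3 / 2)) + real (Suc n) powr (- 3 / 2)"
    proof -
      have "K * real (Suc n) powr (- 3 / 2) \<le> k * real (Suc n) powr (- 3 / 2)"
        using k by (intro mult_right_mono) auto
      then show ?thesis using e[OF nN(1)] e2 pw2[of n] by linarith
    qed
    finally show ?thesis by (simp add: algebra_simps)
  qed
  moreover have "summable (\<lambda>n. (k + 2 * (1 + k)\<^sup>2 + 1) * real (Suc n) powr (- 3 / 2))"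
  proof -
    have "summable (\<lambda>n. real n powr (- 3 / 2))" by (simp add: summable_real_powr_iff)
    then show ?thesis by (subst (asm) summable_Suc_iff[symmetric]) (rule summable_mult)
  qed
  ultimately have "\<exists>K. \<forall>n\<ge>N2. \<bar>L n\<bar> \<le> K"
    by (rule bounded_if_summable_increments)
  then obtain J where J: "\<And>n. n \<ge> N2 \<Longrightarrow> \<bar>L n\<bar> \<le> J"
    by blast
  have "exp (- J) * sqrt n \<le> D n \<and> D n \<le> exp J * sqrt n" if n: "n \<ge> N2" for n
  proof -
    have n1: "real n > 0" using n unfolding N2_def by simp
    have "L n = ln (D n) - ln (sqrt n)" unfolding L_def using n1 by (simp add: ln_sqrt)
    then have "D n = exp (L n) * sqrt n" using D[of n] n1 by (simp add: exp_diff)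
    moreover have "exp (- J) \<le> exp (L n)" "exp (L n) \<le> exp J" using J[OF n] by auto
    ultimately show ?thesis by (auto intro!: mult_right_mono)
  qed
  then show ?thesis by (intro exI[of _ "exp (- J)"] exI[of _ "exp J"] exI[of _ N2]) auto
qed

text \<open>A single square may vanish, since \<open>x\<close> may be a zero of a Hermite
  polynomial. The sum of two consecutive ones is instead tied to the partial sums by
  Christoffel-Darboux, and their growth follows from
  \<open>sqrt_growth_from_increments\<close>.\<close>

lemma hermite_square_sum_bounds:
  fixes x :: real
  shows "\<exists>a b N. 0 < a \<and> 0 < b \<and> (\<forall>n\<ge>N.
     a * real (Suc n) powr (- 1 / 2) \<le> (hermite (Suc n) x)\<^sup>2 / fact (Suc n) + (hermite n x)\<^sup>2 / fact n \<and>
     (hermite (Suc n) x)\<^sup>2 / fact (Suc n) + (hermite n x)\<^sup>2 / fact n \<le> b * real (Suc n) powr (- 1 / 2))"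
proof -
  define w where "w n = (hermite n x)\<^sup>2 / fact n" for n
  define S where "S n = (\<Sum>k\<le>n. w k)" for n
  define A where "A n = w (Suc n) + w n" for n
  \<comment> \<open>Averaging removes the parity effect: the increments of \<open>D\<close> are the sums \<open>A\<close> of two
    consecutive terms, which is what Christoffel--Darboux controls.\<close>
  define D where "D n = S (Suc n) + S n" for n
  have w0: "w n \<ge> 0" for n unfolding w_def by simp
  have S1: "S n \<ge> 1" for n
  proof -
    have "w 0 \<le> S n" unfolding S_def by (intro member_le_sum) (auto simp: w0)
    then show ?thesis by (simp add: w_def)
  qed
  have Dpos: "D n > 0" for n using S1[of n] S1[of "Suc n"] unfolding D_def by linarith
  have A0: "A n \<ge> 0" for n unfolding A_def using w0 by (simp add: add_nonneg_nonneg)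
  \<comment> \<open>Christoffel-Darboux leaves only the mixed term x H_{n+1} H_n / n!. After
    normalising each factor by the root of its factorial, the inequality 2ab <= a^2 + b^2 bounds it
    by \<open>A n\<close>; the factor sqrt (n+1) is the quotient of the two normalisations.\<close>
  have cd: "\<bar>S n - real (Suc n) * A n\<bar> \<le> \<bar>x\<bar> / 2 * sqrt (real (Suc n)) * A n" for n
  proof -
    have "S n - real (Suc n) * A n = - (x * (hermite (Suc n) x * hermite n x / fact n))"
    proof -
      have "hermite (Suc n) x ^ 2 / fact n = real (Suc n) * (hermite (Suc n) x ^ 2 / fact (Suc n))"
        unfolding fact_Suc of_nat_mult by simp
      then show ?thesis
        unfolding S_def w_def hermite_christoffel_darboux A_def
        by (simp add: diff_divide_distrib add_divide_distrib distrib_left mult.assoc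
              del: hermite.simps fact_Suc of_nat_Suc)
    qed
    also have "\<bar>\<dots>\<bar> = \<bar>x\<bar> * (\<bar>hermite (Suc n) x\<bar> * \<bar>hermite n x\<bar> / fact n)"
      by (simp add: abs_mult)
    also have "\<dots> \<le> \<bar>x\<bar> * (sqrt (real (Suc n)) * A n / 2)"
    proof (rule mult_left_mono)
      let ?a = "\<bar>hermite (Suc n) x\<bar> / sqrt (fact (Suc n))" and ?b = "\<bar>hermite n x\<bar> / sqrt (fact n)"
      have "2 * ?a * ?b \<le> ?a\<^sup>2 + ?b\<^sup>2" by (rule sum_squares_bound)
      also have "\<dots> = A n" unfolding A_def w_def by (simp add: power_divide del: hermite.simps fact_Suc)
      finally have "sqrt (real (Suc n)) * (?a * ?b) \<le> sqrt (real (Suc n)) * (A n / 2)"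
        by (intro mult_left_mono) (simp_all add: mult_ac del: hermite.simps fact_Suc of_nat_Suc)
      moreover have "sqrt (real (Suc n)) * (?a * ?b) = \<bar>hermite (Suc n) x\<bar> * \<bar>hermite n x\<bar> / fact n"
      proof -
        have "sqrt (fact (Suc n)) = sqrt (real (Suc n)) * sqrt (fact n)"
          unfolding fact_Suc of_nat_mult by (simp add: real_sqrt_mult)
        then have ab: "?a * ?b = \<bar>hermite (Suc n) x\<bar> * \<bar>hermite n x\<bar>
            / (sqrt (real (Suc n)) * (sqrt (fact n) * sqrt (fact n)))"
          by (simp only: times_divide_times_eq mult.assoc)
        show ?thesis unfolding ab by (simp del: of_nat_Suc hermite.simps fact_Suc)
      qed
      ultimately show "\<bar>hermite (Suc n) x\<bar> * \<bar>hermite n x\<bar> / fact n \<le> sqrt (real (Suc n)) * A n / 2"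
        by (metis times_divide_eq_right)
    qed simp
    finally show ?thesis by (simp add: mult_ac)
  qed
  \<comment> \<open>From here on \<bar>x\<bar> <= sqrt (n+1), so the error in \<open>cd\<close> is
    at most half of (n+1) \<open>A n\<close>, which makes this quantity comparable to
    \<open>S n\<close>.\<close>
  obtain M where M: "real M \<ge> x\<^sup>2" using real_arch_simple by blast
  have AS: "real (Suc n) * A n \<le> 2 * S n \<and> S n \<le> 2 * real (Suc n) * A n" if "n \<ge> M" for n
  proof -
    have "x\<^sup>2 \<le> real (Suc n)" using M that by simp
    then have "\<bar>x\<bar> \<le> sqrt (real (Suc n))" by (metis real_sqrt_abs real_sqrt_le_iff)
    then have "\<bar>x\<bar> / 2 * sqrt (real (Suc n)) * A n \<le> sqrt (real (Suc n)) / 2 * sqrt (real (Suc n)) * A n"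
      by (intro mult_right_mono) (auto simp: A0)
    also have "\<dots> = real (Suc n) * A n / 2" by simp
    finally have "\<bar>S n - real (Suc n) * A n\<bar> \<le> real (Suc n) * A n / 2" using cd[of n] by linarith
    moreover have "0 \<le> real (Suc n) * A n" using A0[of n] by simp
    ultimately have "\<bar>S n - X\<bar> \<le> X / 2" "0 \<le> X" if "X = real (Suc n) * A n" for X
      unfolding that by blast+
    then show ?thesis unfolding mult.assoc[of 2] by (smt (verit) field_sum_of_halves)
  qed
  have DA: "D (Suc n) - D n = A (Suc n)" for n unfolding D_def S_def A_def by simp
  have DS: "D n = 2 * S n + w (Suc n)" for n unfolding D_def S_def by simp
  have wA: "w (Suc n) \<le> A n" for n unfolding A_def using w0 by simp
  have inc: "\<bar>D (Suc n) - D n - D (Suc n) / (2 * real (Suc n))\<bar>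
      \<le> (\<bar>x\<bar> + 3) * D (Suc n) * real (Suc n) powr (- 3 / 2)" if n: "n \<ge> M" for n
  proof -
    define m where "m = real (Suc (Suc n))"
    have m: "m \<ge> 1" "real (Suc n) > 0" "m = real (Suc n) + 1" unfolding m_def by auto
    have a: "m * A (Suc n) \<le> D (Suc n)"
      using AS[of "Suc n"] n DS[of "Suc n"] w0[of "Suc (Suc n)"] unfolding m_def by auto
    have "\<bar>2 * m * A (Suc n) - D (Suc n)\<bar> \<le> 2 * (\<bar>x\<bar> / 2 * sqrt m * A (Suc n)) + A (Suc n)"
      using cd[of "Suc n"] DS[of "Suc n"] wA[of "Suc n"] w0[of "Suc (Suc n)"] unfolding m_def[symmetric]
      by linarith
    also have "\<dots> = (\<bar>x\<bar> * sqrt m + 1) * A (Suc n)" by (simp add: algebra_simps)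
    also have "\<dots> \<le> (\<bar>x\<bar> * sqrt m + 1 * sqrt m) * A (Suc n)"
      using m by (intro mult_right_mono A0 add_mono mult_mono) auto
    also have "\<dots> = (\<bar>x\<bar> + 1) * sqrt m * A (Suc n)" by (simp add: algebra_simps)
    finally have b: "\<bar>2 * m * A (Suc n) - D (Suc n)\<bar> \<le> (\<bar>x\<bar> + 1) * sqrt m * A (Suc n)" .
    have "2 * real (Suc n) * (D (Suc n) - D n - D (Suc n) / (2 * real (Suc n)))
       = (2 * m * A (Suc n) - D (Suc n)) - 2 * A (Suc n)"
      unfolding DA using m by (simp add: field_simps)
    also have "\<bar>\<dots>\<bar> \<le> (\<bar>x\<bar> + 1) * sqrt m * A (Suc n) + 2 * A (Suc n)"
      using b A0[of "Suc n"] by linarith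
    also have "\<dots> = ((\<bar>x\<bar> + 1) * sqrt m + 2) * A (Suc n)" by (simp add: algebra_simps)
    also have "\<dots> \<le> ((\<bar>x\<bar> + 1) * sqrt m + 2 * sqrt m) * A (Suc n)"
      using m by (intro mult_right_mono A0 add_mono) auto
    also have "\<dots> = (\<bar>x\<bar> + 3) * (sqrt m * A (Suc n))" by (simp add: algebra_simps)
    also have "sqrt m * A (Suc n) = m * A (Suc n) / sqrt m"
      using m by (simp add: field_simps real_sqrt_mult[symmetric])
    also have "\<dots> \<le> D (Suc n) / sqrt m" using a m by (intro divide_right_mono) auto
    also have "\<dots> \<le> D (Suc n) / sqrt (real (Suc n))"
      using m Dpos[of "Suc n"] by (intro divide_left_mono) (auto intro: less_imp_le)
    finally have le: "2 * real (Suc n) * \<bar>D (Suc n) - D n - D (Suc n) / (2 * real (Suc n))\<bar>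
        \<le> (\<bar>x\<bar> + 3) * (D (Suc n) / sqrt (real (Suc n)))"
      by (simp add: abs_mult mult_left_mono)
    have gen: "z \<le> r / q" if "2 * q * z \<le> r" "0 \<le> z" "0 < q" for z r q :: real
    proof -
      have "0 \<le> q * z" using that by simp
      then have "z * q \<le> r" using that(1) by (simp add: mult_ac)
      then show ?thesis using that(3) by (simp add: pos_le_divide_eq)
    qed
    have "\<bar>D (Suc n) - D n - D (Suc n) / (2 * real (Suc n))\<bar>
        \<le> (\<bar>x\<bar> + 3) * (D (Suc n) / sqrt (real (Suc n))) / real (Suc n)"
      by (rule gen[OF le abs_ge_zero m(2)])
    also have "\<dots> = (\<bar>x\<bar> + 3) * D (Suc n) * (1 / (real (Suc n) * sqrt (real (Suc n))))"
      by (simp add: field_simps)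
    also have "1 / (real (Suc n) * sqrt (real (Suc n))) = real (Suc n) powr (- 3 / 2)"
    proof -
      have "real (Suc n) powr (3 / 2) = real (Suc n) powr (1 + 1 / 2)" by simp
      also have "\<dots> = real (Suc n) * sqrt (real (Suc n))"
        unfolding powr_add by (simp add: powr_half_sqrt)
      finally show ?thesis using powr_minus_divide[of "real (Suc n)" "3/2"] by simp
    qed
    finally show ?thesis .
  qed
  obtain a b N where ab: "0 < a" "0 < b"
    and N: "\<And>n. n \<ge> N \<Longrightarrow> a * sqrt n \<le> D n \<and> D n \<le> b * sqrt n"
  proof -
    have "\<exists>a b N. 0 < a \<and> 0 < b \<and> (\<forall>n\<ge>N. a * sqrt n \<le> D n \<and> D n \<le> b * sqrt n)"
      by (rule sqrt_growth_from_increments[OF Dpos inc])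
    then show ?thesis using that by blast
  qed
  \<comment> \<open>The 10 is 2 times 5: sqrt (n+1) <= 2 sqrt n for n >= 1, and \<open>D n\<close>
    is at most 4 (n+1) \<open>A n\<close> + \<open>A n\<close>, hence at most 5 (n+1)
    \<open>A n\<close>.\<close>
  have main: "a / 10 * real (Suc n) powr (- 1 / 2) \<le> A n \<and> A n \<le> b * real (Suc n) powr (- 1 / 2)"
    if n: "n \<ge> max 1 (max M N)" for n
  proof -
    have nn: "n \<ge> 1" "n \<ge> M" "n \<ge> N" using n by auto
    define s where "s = sqrt (real (Suc n))"
    have s: "s > 0" "s * s = real (Suc n)" unfolding s_def by auto
    have p: "real (Suc n) powr (- 1 / 2) = 1 / s"
      unfolding s_def using powr_minus_divide[of "real (Suc n)" "1/2"] by (simp add: powr_half_sqrt)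
    have "real (Suc n) * A n \<le> D n" using AS[OF nn(2)] DS[of n] w0[of "Suc n"] by simp
    also have "\<dots> \<le> b * s"
    proof -
      have "b * sqrt n \<le> b * s"
        using ab unfolding s_def by (intro mult_left_mono real_sqrt_le_mono) auto
      then show ?thesis using N[OF nn(3)] by linarith
    qed
    finally have "s * (s * A n) \<le> s * b" by (simp only: s(2)[symmetric] mult_ac)
    then have u: "s * A n \<le> b" using s(1) by simp
    have "s \<le> sqrt (4 * real n)" unfolding s_def using nn(1) by (intro real_sqrt_le_mono) simp
    then have "s / 2 \<le> sqrt n" by (simp add: real_sqrt_mult)
    then have "a * (s / 2) \<le> a * sqrt n" using ab by (intro mult_left_mono) auto
    also have "\<dots> \<le> D n" using N[OF nn(3)] by simp
    also have "\<dots> \<le> 4 * real (Suc n) * A n + A n" using AS[OF nn(2)] DS[of n] wA[of n] by linarith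
    finally have "a * (s / 2) \<le> (4 * real (Suc n) + 1) * A n" by (simp add: algebra_simps)
    also have "\<dots> \<le> (5 * (s * s)) * A n" unfolding s(2) by (intro mult_right_mono A0) simp
    finally have "s * (a / 2) \<le> s * (5 * (s * A n))" by (simp only: mult_ac times_divide_eq_right)
    then have "a / 2 \<le> 5 * (s * A n)" using s(1) by simp
    then have "a / 10 \<le> s * A n" by simp
    then show ?thesis using u s(1) unfolding p by (simp add: field_simps)
  qed
  show ?thesis
    using main ab unfolding A_def w_def
    by (intro exI[of _ "a / 10"] exI[of _ b] exI[of _ "max 1 (max M N)"]) auto
qed

text \<open>This is the critical exponent. Adding each term to its successor gives at least a
  multiple of n^{-1/2} n^{-1/2}, so the harmonic series would converge.\<close>

lemma hermite_square_powr_not_summable: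
  "\<not> summable (\<lambda>n. (hermite n x)\<^sup>2 / fact n * real (Suc n) powr (- 1 / 2))"
proof
  define w where "w n = (hermite n x)\<^sup>2 / fact n" for n
  assume "summable (\<lambda>n. (hermite n x)\<^sup>2 / fact n * real (Suc n) powr (- 1 / 2))"
  then have g: "summable (\<lambda>n. w n * real (Suc n) powr (- 1 / 2))" unfolding w_def .
  have g2: "summable (\<lambda>n. w n * real (Suc n) powr (- 1 / 2) + w (Suc n) * real (Suc (Suc n)) powr (- 1 / 2))"
    using summable_add[OF g] g[THEN summable_Suc_iff[THEN iffD2]] by simp
  obtain a b N where a: "0 < a" and N: "\<And>n. n \<ge> N \<Longrightarrow> a * real (Suc n) powr (- 1 / 2) \<le> w (Suc n) + w n"
    using hermite_square_sum_bounds[of x] unfolding w_def by blast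
  have "summable (\<lambda>n. a * (1 / real (Suc (Suc n))))"
  proof (rule summable_comparison_test'[OF g2, of N])
    fix n assume n: "n \<ge> N"
    have w0: "0 \<le> w n" unfolding w_def by simp
    \<comment> \<open>\<open>z\<close> is the smaller of the two weights in a pair. Factoring it out
      leaves w_{n+1} + w_n, which is at least \<open>a * y\<close> and so at least
      \<open>a * z\<close>.\<close>
    define y z where "y = real (Suc n) powr (- 1 / 2)" and "z = real (Suc (Suc n)) powr (- 1 / 2)"
    have yz: "z \<le> y" "0 \<le> z" unfolding y_def z_def by (auto intro: powr_mono2')
    have zz: "z * z = 1 / real (Suc (Suc n))"
      unfolding z_def powr_add[symmetric] using powr_minus_divide[of "real (Suc (Suc n))" 1] by simp
    have "a * (z * z) \<le> a * y * z"
      using yz a by (simp add: mult_mono mult_right_mono)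
    also have "\<dots> \<le> (w (Suc n) + w n) * z"
      using N[OF n] yz unfolding y_def by (intro mult_right_mono) auto
    also have "\<dots> \<le> w n * y + w (Suc n) * z"
      using mult_left_mono[OF yz(1) w0] by (simp add: algebra_simps)
    finally have "a * (z * z) \<le> w n * y + w (Suc n) * z" .
    moreover have "norm (a * (1 / real (Suc (Suc n)))) = a * (z * z)"
      unfolding zz using a by simp
    ultimately show "norm (a * (1 / real (Suc (Suc n))))
        \<le> w n * real (Suc n) powr (- 1 / 2) + w (Suc n) * real (Suc (Suc n)) powr (- 1 / 2)"
      by (simp only: y_def z_def)
  qed
  then have "summable (\<lambda>n. 1 / real (Suc (Suc n)))"
    using a by (subst (asm) summable_cmult_iff) auto
  then have "summable (\<lambda>n. 1 / real n)"
    by (simp only: summable_Suc_iff[of "\<lambda>n. 1 / real (Suc n)"] summable_Suc_iff[of "\<lambda>n. 1 / real n"])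
  then show False using not_summable_harmonic[where 'a = real] by (simp add: inverse_eq_divide)
qed

section \<open>Hermite coefficients of a half-line\<close>

text \<open>One recurrence for all \<open>q\<close>: at \<open>q = 0\<close> the truncated index
  \<open>q - 1\<close> is harmless because its coefficient is 0.\<close>

lemma hermite_Suc: "hermite (Suc q) x = x * hermite q x - real q * hermite (q - 1) x"
  by (cases q) auto

lemma hermite_has_real_derivative:
  "(hermite q has_real_derivative real q * hermite (q - 1) x) (at x)"
proof (induction q x rule: hermite.induct)
  case (1 x)
  have "hermite 0 = (\<lambda>x. 1)" by (rule ext) simp
  then show ?case by simp
next
  case (2 x)
  have "hermite (Suc 0) = (\<lambda>x. x)" by (rule ext) simp
  then show ?case by simp
next
  case (3 q x)
  have eq: "hermite (Suc (Suc q)) = (\<lambda>x. x * hermite (Suc q) x - real (Suc q) * hermite q x)"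
    by (rule ext) simp
  have "((\<lambda>x. x * hermite (Suc q) x - real (Suc q) * hermite q x) has_real_derivative
      x * (real (Suc q) * hermite q x) + hermite (Suc q) x
        - real (Suc q) * (real q * hermite (q - 1) x)) (at x)"
    using 3 by (auto intro!: derivative_eq_intros simp del: hermite.simps of_nat_Suc)
  moreover have "x * (real (Suc q) * hermite q x) + hermite (Suc q) x
        - real (Suc q) * (real q * hermite (q - 1) x)
      = real (Suc (Suc q)) * hermite (Suc q) x"
    unfolding hermite_Suc[of q] by (simp add: algebra_simps)
  ultimately show ?case unfolding eq[symmetric] by (simp del: hermite.simps of_nat_Suc)
qed

lemma borel_measurable_hermite [measurable]: "hermite q \<in> borel_measurable borel"
  by (rule borel_measurable_continuous_onI)
     (meson hermite_has_real_derivative DERIV_isCont continuous_at_imp_continuous_on)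

lemma std_normal_density_has_real_derivative:
  "(std_normal_density has_real_derivative - x * std_normal_density x) (at x)"
proof -
  have "((\<lambda>x. k * exp (- x\<^sup>2 / 2)) has_real_derivative - x * (k * exp (- x\<^sup>2 / 2))) (at x)" for k :: real
    by (auto intro!: derivative_eq_intros)
  from this[of "1 / sqrt (2 * pi)"] show ?thesis by (simp add: std_normal_density_def[abs_def])
qed

text \<open>The free power x^k makes the induction close: the factor x of the recurrence is absorbed
  into it.\<close>

lemma integrable_hermite_moment:
  "integrable lborel (\<lambda>x. x ^ k * hermite q x * std_normal_density x)"
\<comment> \<open>\<open>hermite.induct\<close> also runs over the real argument of
  \<open>hermite\<close>, on which the claim does not depend; 0 is a dummy value.\<close>
proof (induction q "0::real" arbitrary: k rule: hermite.induct)
  case 1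
  show ?case using integrable_std_normal_moment[of k] by (simp add: mult.commute)
next
  case 2
  show ?case using integrable_std_normal_moment[of "Suc k"] by (simp add: mult_ac)
next
  case (3 q)
  have "integrable lborel (\<lambda>x. x ^ Suc k * hermite (Suc q) x * std_normal_density x
      - real (Suc q) * (x ^ k * hermite q x * std_normal_density x))"
    by (intro Bochner_Integration.integrable_diff integrable_mult_right 3)
  then show ?case by (simp add: algebra_simps)
qed

lemma tendsto_power_std_normal_density: "((\<lambda>x. x ^ k * std_normal_density x) \<longlongrightarrow> 0) at_top"
proof (rule Lim_null_comparison[OF _ tendsto_power_div_exp_0])
  show "eventually (\<lambda>x. norm (x ^ k * std_normal_density x) \<le> x ^ k / exp x) at_top"
    using eventually_ge_at_top[of 2]
  proof eventually_elim
    case (elim x)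
    have "1 / sqrt (2 * pi) \<le> 1" using pi_gt3 by simp
    moreover have "exp (- x\<^sup>2 / 2) \<le> exp (- x)" using elim by (simp add: power2_eq_square)
    ultimately have "1 / sqrt (2 * pi) * exp (- x\<^sup>2 / 2) \<le> 1 * exp (- x)"
      by (intro mult_mono) auto
    then have "x ^ k * std_normal_density x \<le> x ^ k * exp (- x)"
      using elim unfolding std_normal_density_def by (intro mult_left_mono) auto
    then show ?case using elim by (simp add: abs_mult exp_minus field_simps)
  qed
qed

text \<open>Supplies the vanishing boundary term at infinity for the half-line integral; the
  induction is the one used for integrability.\<close>

lemma tendsto_hermite_moment:
  "((\<lambda>x. x ^ k * hermite q x * std_normal_density x) \<longlongrightarrow> 0) at_top"
proof (induction q "0::real" arbitrary: k rule: hermite.induct)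
  case 1
  show ?case using tendsto_power_std_normal_density[of k] by simp
next
  case 2
  show ?case using tendsto_power_std_normal_density[of "Suc k"] by (simp add: mult_ac)
next
  case (3 q)
  have "((\<lambda>x. x ^ Suc k * hermite (Suc q) x * std_normal_density x
      - real (Suc q) * (x ^ k * hermite q x * std_normal_density x)) \<longlongrightarrow> 0 - real (Suc q) * 0) at_top"
    by (intro tendsto_intros 3)
  then show ?case by (simp add: algebra_simps)
qed

text \<open>By H_q' = q H_{q-1} and phi' = -x phi, the function - H_q phi is an antiderivative of
  H_{q+1} phi, so the integral over the half-line reduces to the boundary value at
  \<open>u\<close>.\<close>

lemma hermite_coeff_indicator_atLeast:
  "hermite_coeff (Suc q) (indicator {u..}) = hermite q u * std_normal_density u / fact (Suc q)"
proof -
  let ?f = "\<lambda>x. hermite (Suc q) x * std_normal_density x"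
  let ?F = "\<lambda>x. - (hermite q x * std_normal_density x)"
  have der: "(?F has_real_derivative ?f x) (at x)" for x
  proof -
    have "(?F has_real_derivative - (hermite q x * (- x * std_normal_density x)
        + real q * hermite (q - 1) x * std_normal_density x)) (at x)"
      by (rule DERIV_minus[OF DERIV_mult'[OF hermite_has_real_derivative
            std_normal_density_has_real_derivative]])
    then show ?thesis unfolding hermite_Suc by (simp add: algebra_simps)
  qed
  have cont: "isCont ?f x" for x
    by (intro continuous_mult DERIV_isCont[OF hermite_has_real_derivative]
        DERIV_isCont[OF std_normal_density_has_real_derivative])
  have int: "integrable lborel ?f"
    using integrable_hermite_moment[of 0 "Suc q"] by simp
  have "(LBINT x=ereal u..\<infinity>. ?f x) = 0 - ?F u"
  proof (rule interval_integral_FTC_integrable)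
    show "(?F has_vector_derivative ?f x) (at x)" for x
      using der by (simp add: has_real_derivative_iff_has_vector_derivative)
    show "set_integrable lborel (einterval (ereal u) \<infinity>) ?f"
      unfolding set_integrable_def by (intro integrable_mult_indicator int) auto
    show "((?F \<circ> real_of_ereal) \<longlongrightarrow> ?F u) (at_right (ereal u))"
      unfolding ereal_tendsto_simps1
      using DERIV_isCont[OF der, of u] by (simp add: isCont_def filterlim_at_split)
    show "((?F \<circ> real_of_ereal) \<longlongrightarrow> 0) (at_left \<infinity>)"
      unfolding ereal_tendsto_simps1
      using tendsto_minus[OF tendsto_hermite_moment[of 0 q]] by simp
  qed (use cont in auto)
  moreover have "(LBINT x=ereal u..\<infinity>. ?f x) = (LINT x|lborel. indicator {u<..} x *\<^sub>R ?f x)"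
    by (simp add: interval_integral_to_infinity_eq set_lebesgue_integral_def)
  \<comment> \<open>The interval integral lives on the open half-line, the coefficient on the closed
    one; they differ by a null set.\<close>
  moreover have "\<dots> = (LINT x|lborel. hermite (Suc q) x * indicator {u..} x * std_normal_density x)"
  proof (rule integral_cong_AE)
    show "AE x in lborel. indicator {u<..} x *\<^sub>R ?f x
        = hermite (Suc q) x * indicator {u..} x * std_normal_density x"
      using AE_lborel_singleton[of u] by eventually_elim (auto simp: indicator_def)
  qed (auto simp del: hermite.simps)
  ultimately show ?thesis unfolding hermite_coeff_def by simp
qed

section \<open>The covariance function\<close>

text \<open>The right-hand side is the second moment of B x - s B y + t B z. Only covariances of the
  field enter, not its Gaussian law.\<close>

lemma field_covariance_quadratic_form_nonneg:
  assumes field: "centered_stationary_gaussian_field M B C" and C0: "C 0 = 1"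
  shows "0 \<le> 1 + s\<^sup>2 + t\<^sup>2 - 2 * s * C (x - y) + 2 * t * C (x - z) - 2 * s * t * C (y - z)"
proof -
  have i: "integrable M (\<lambda>\<omega>. B x \<omega> * B y \<omega>)" for x y
    using field unfolding centered_stationary_gaussian_field_def by blast
  have e: "(\<integral>\<omega>. B x \<omega> * B y \<omega> \<partial>M) = C (x - y)" for x y
    using field unfolding centered_stationary_gaussian_field_def by blast
  have "0 \<le> (\<integral>\<omega>. (B x \<omega> - s * B y \<omega> + t * B z \<omega>)\<^sup>2 \<partial>M)"
    by (rule Bochner_Integration.integral_nonneg) simp
  also have "\<dots> = (\<integral>\<omega>. B x \<omega> * B x \<omega> + s\<^sup>2 * (B y \<omega> * B y \<omega>) + t\<^sup>2 * (B z \<omega> * B z \<omega>)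
      - 2 * s * (B x \<omega> * B y \<omega>) + 2 * t * (B x \<omega> * B z \<omega>) - 2 * s * t * (B y \<omega> * B z \<omega>) \<partial>M)"
    by (rule Bochner_Integration.integral_cong) (auto simp: power2_eq_square algebra_simps)
  also have "\<dots> = 1 + s\<^sup>2 + t\<^sup>2 - 2 * s * C (x - y) + 2 * t * C (x - z) - 2 * s * t * C (y - z)"
    by (simp add: i e C0)
  finally show ?thesis .
qed

lemma covariance_abs_le_one:
  assumes "centered_stationary_gaussian_field M B C" "C 0 = 1"
  shows "\<bar>C h\<bar> \<le> 1"
  using field_covariance_quadratic_form_nonneg[OF assms, of 1 0 h 0 0]
    field_covariance_quadratic_form_nonneg[OF assms, of "-1" 0 h 0 0]
  by auto

text \<open>If \<open>C h = \<plusminus>1\<close>, then \<open>B (x + h) = \<plusminus>B x\<close> almost surely, so \<open>\<bar>C\<bar>\<close> is \<open>h\<close>-periodic.\<close>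

lemma covariance_shift:
  assumes "centered_stationary_gaussian_field M B C" "C 0 = 1" and "\<bar>C h\<bar> = 1"
  shows "C (y + h) = C h * C y"
proof -
  define d where "d = C (y + h) - C h * C y"
  have "(C h)\<^sup>2 = 1" using assms(3) by (metis power2_abs one_power2)
  \<comment> \<open>At the points y + h, y, 0 with s = C h the terms without t cancel because (C
    h)^2 = 1. What remains is t^2 + 2 t d, whose minimum -d^2 is attained at t = -d.\<close>
  then have "0 \<le> - d\<^sup>2"
    using field_covariance_quadratic_form_nonneg[OF assms(1,2), of "C h" "- d" "y + h" y 0]
    unfolding d_def by (simp add: power2_eq_square algebra_simps)
  then have "d = 0" by simp
  then show ?thesis by (simp add: d_def)
qed

text \<open>If \<bar>C h\<bar> were 1, iterating \<open>covariance_shift\<close> would give \<bar>C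
  (n h)\<bar> = 1 for every n, against the decay at infinity.\<close>

lemma covariance_abs_less_one:
  fixes C :: "real^'n \<Rightarrow> real"
  assumes field: "centered_stationary_gaussian_field M B C" and C0: "C 0 = 1"
    and decay: "\<And>x. x \<noteq> 0 \<Longrightarrow> \<bar>C x\<bar> \<le> C1 * norm x powr (- \<delta>)" and "\<delta> > 0"
    and h: "h \<noteq> 0"
  shows "\<bar>C h\<bar> < 1"
proof (rule ccontr)
  assume "\<not> \<bar>C h\<bar> < 1"
  then have one: "\<bar>C h\<bar> = 1" using covariance_abs_le_one[OF field C0, of h] by simp
  have per: "\<bar>C (real n *\<^sub>R h)\<bar> = 1" for n
  proof (induction n)
    case 0 then show ?case by (simp add: C0)
  next
    case (Suc n)
    have "C (real n *\<^sub>R h + h) = C h * C (real n *\<^sub>R h)"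
      by (rule covariance_shift[OF field C0 one])
    then show ?case using Suc one by (simp add: scaleR_add_left add.commute abs_mult)
  qed
  have "((\<lambda>n. C1 * (real n * norm h) powr (- \<delta>)) \<longlongrightarrow> C1 * 0) sequentially"
  proof (intro tendsto_mult tendsto_const tendsto_neg_powr)
    show "filterlim (\<lambda>n. real n * norm h) at_top sequentially"
      by (rule filterlim_at_top_mult_tendsto_pos[OF tendsto_const _ filterlim_real_sequentially])
        (use h in simp)
  qed (use \<open>\<delta> > 0\<close> in auto)
  then have "eventually (\<lambda>n. C1 * (real n * norm h) powr (- \<delta>) < 1) sequentially"
    by (auto dest: order_tendstoD(2)[where a=1])
  then have "eventually (\<lambda>n. C1 * (real n * norm h) powr (- \<delta>) < 1 \<and> n > 0) sequentially"
    by (intro eventually_conj eventually_gt_at_top)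
  then obtain n where n: "C1 * (real n * norm h) powr (- \<delta>) < 1" "n > 0"
    by (auto simp: eventually_sequentially)
  then show False using decay[of "real n *\<^sub>R h"] per[of n] h by simp
qed

text \<open>Near 0 the local hypothesis applies. Away from 0, on the compact shell up to radius
  \<open>R\<close>, continuity keeps \<bar>C\<bar> below some \<rho> < 1, and a small
  \<open>c\<close> turns this constant gap into a multiple of \<bar>x\<bar>^\<alpha>.\<close>

lemma covariance_bounds:
  fixes C :: "'a::euclidean_space \<Rightarrow> real"
  assumes cont: "continuous_on UNIV C"
    and less: "\<And>x. x \<noteq> 0 \<Longrightarrow> \<bar>C x\<bar> < 1"
    and pos: "C2 > 0" "C3 > 0" "\<alpha> > 0" "\<epsilon> > 0"
    and near0: "\<And>x. norm x \<le> \<epsilon> \<Longrightarrow>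
                  C2 * norm x powr \<alpha> \<le> 1 - C x \<and> 1 - C x \<le> C3 * norm x powr \<alpha>"
    and R: "R > 0"
  obtains c e where "c > 0" "e > 0"
    "\<And>x. norm x \<le> e \<Longrightarrow> 0 \<le> C x \<and> 1 - C3 * norm x powr \<alpha> \<le> C x"
    "\<And>x. norm x \<le> R \<Longrightarrow> \<bar>C x\<bar> \<le> 1 - c * norm x powr \<alpha>"
proof -
  \<comment> \<open>Within this radius C3 \<bar>x\<bar>^\<alpha> <= 1, so \<open>C\<close> is
    nonnegative there and equals its absolute value.\<close>
  define e where "e = min \<epsilon> ((1 / C3) powr (1 / \<alpha>))"
  have e: "e > 0" "e \<le> \<epsilon>" using pos unfolding e_def by auto
  have e3: "C3 * norm x powr \<alpha> \<le> 1" if "norm x \<le> e" for x :: "'a"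
  proof -
    have "norm x powr \<alpha> \<le> ((1 / C3) powr (1 / \<alpha>)) powr \<alpha>"
      using that pos unfolding e_def by (intro powr_mono2) auto
    also have "\<dots> = 1 / C3" using pos by (simp add: powr_powr)
    finally show ?thesis using pos by (simp add: field_simps)
  qed
  have near: "0 \<le> C x \<and> 1 - C3 * norm x powr \<alpha> \<le> C x" if "norm x \<le> e" for x
    using near0[of x] e3[OF that] that e by auto
  define K where "K = cball (0::'a) R - ball 0 e"
  obtain \<rho> where \<rho>: "\<rho> < 1" "\<And>x. x \<in> K \<Longrightarrow> \<bar>C x\<bar> \<le> \<rho>"
  proof (cases "K = {}")
    case True then show ?thesis using that[of 0] by auto
  next
    case False
    have "compact K" unfolding K_def by (intro compact_diff) auto
    moreover have "continuous_on K (\<lambda>x. \<bar>C x\<bar>)"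
      using cont by (intro continuous_intros) (auto intro: continuous_on_subset)
    ultimately obtain y where y: "y \<in> K" "\<And>x. x \<in> K \<Longrightarrow> \<bar>C x\<bar> \<le> \<bar>C y\<bar>"
      using continuous_attains_sup[OF _ False] by blast
    have "y \<noteq> 0" using y(1) e unfolding K_def by auto
    then show ?thesis using that[of "\<bar>C y\<bar>"] less[of y] y(2) by blast
  qed
  define c where "c = min C2 ((1 - \<rho>) / R powr \<alpha>)"
  have Rp: "R powr \<alpha> > 0" using R by simp
  have c: "c > 0" using pos \<rho>(1) Rp unfolding c_def by simp
  have "\<bar>C x\<bar> \<le> 1 - c * norm x powr \<alpha>" if x: "norm x \<le> R" for x
  proof (cases "norm x \<le> e")
    case True
    have "c * norm x powr \<alpha> \<le> C2 * norm x powr \<alpha>"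
      unfolding c_def by (intro mult_right_mono) auto
    then show ?thesis using near[OF True] near0[of x] True e by auto
  next
    case False
    then have "x \<in> K" using x unfolding K_def by auto
    have "c * norm x powr \<alpha> \<le> (1 - \<rho>) / R powr \<alpha> * R powr \<alpha>"
      using x pos \<rho>(1) c unfolding c_def by (intro mult_mono powr_mono2) auto
    also have "\<dots> = 1 - \<rho>" using Rp by simp
    finally show ?thesis using \<rho>(2)[OF \<open>x \<in> K\<close>] by simp
  qed
  then show ?thesis using that c e(1) near by blast
qed

section \<open>The integrals of the powers of the covariance\<close>

lemma nn_integral_lborel_shift:
  fixes f :: "'a::euclidean_space \<Rightarrow> ennreal"
  assumes [measurable]: "f \<in> borel_measurable borel"
  shows "(\<integral>\<^sup>+y. f (x + y) \<partial>lborel) = (\<integral>\<^sup>+y. f y \<partial>lborel)"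
  by (subst (2) lborel_distr_plus[of x, symmetric]) (simp add: nn_integral_distr)

lemma nn_integral_lborel_scale:
  fixes f :: "'a::euclidean_space \<Rightarrow> ennreal"
  assumes [measurable]: "f \<in> borel_measurable borel" and "c \<noteq> 0"
  shows "(\<integral>\<^sup>+y. f y \<partial>lborel) = ennreal (\<bar>c\<bar> ^ DIM('a)) * (\<integral>\<^sup>+y. f (c *\<^sub>R y) \<partial>lborel)"
  by (subst lborel_affine[OF \<open>c \<noteq> 0\<close>, of 0])
    (simp add: nn_integral_density nn_integral_distr nn_integral_cmult)

lemma nn_integral_lborel_reflect:
  fixes f :: "'a::euclidean_space \<Rightarrow> ennreal"
  assumes [measurable]: "f \<in> borel_measurable borel"
  shows "(\<integral>\<^sup>+y. f (x - y) \<partial>lborel) = (\<integral>\<^sup>+y. f y \<partial>lborel)"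
  using nn_integral_lborel_scale[of f "-1"] nn_integral_lborel_shift[of "\<lambda>y. f (- y)" "- x"]
  by simp

section \<open>Integrals of exp (- c q \<bar>x\<bar>^\<alpha>)\<close>

lemma nn_integral_inverse_one_plus_square: "(\<integral>\<^sup>+x. ennreal (1 / (1 + x\<^sup>2)) \<partial>lborel) < \<infinity>"
proof -
  have "integrable lborel (\<lambda>x::real. 1 / (1 + x\<^sup>2))"
    using integrable_inverse_1_plus_square by (simp add: set_integrable_def inverse_eq_divide)
  then show ?thesis by (simp add: integrable_iff_bounded)
qed

text \<open>The exponential beats every power of 1 + \<bar>x\<bar>^2, and the d-th power of the
  latter dominates the product of the factors 1 + x_b^2 over the coordinates. The integrand is thus
  bounded by a product of integrable functions of one variable.\<close>

lemma nn_integral_exp_neg_norm_powr_finite: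
  assumes "c > 0" "\<alpha> > 0"
  shows "(\<integral>\<^sup>+x. ennreal (exp (- (c * norm (x::'a::euclidean_space) powr \<alpha>))) \<partial>lborel) < \<infinity>"
proof -
  define N where "N = real DIM('a)"
  have "((\<lambda>t::real. (1 + t\<^sup>2) powr N * exp (- (c * t powr \<alpha>))) \<longlongrightarrow> 0) at_top"
    using assms unfolding N_def by real_asymp
  then have "eventually (\<lambda>t. (1 + t\<^sup>2) powr N * exp (- (c * t powr \<alpha>)) < 1) at_top"
    by (rule order_tendstoD) simp
  then obtain T where T: "\<And>t. t \<ge> T \<Longrightarrow> (1 + t\<^sup>2) powr N * exp (- (c * t powr \<alpha>)) < 1"
    unfolding eventually_at_top_linorder by blast
  define K where "K = max 1 ((1 + T\<^sup>2) powr N)"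
  have K: "(1 + t\<^sup>2) powr N * exp (- (c * t powr \<alpha>)) \<le> K" if "t \<ge> 0" for t
  proof (cases "t \<ge> T")
    case True then show ?thesis using T[OF True] unfolding K_def by simp
  next
    case False
    have "(1 + t\<^sup>2) powr N * exp (- (c * t powr \<alpha>)) \<le> (1 + T\<^sup>2) powr N * 1"
      using False that assms unfolding N_def
      by (intro mult_mono powr_mono2 add_left_mono power_mono) auto
    then show ?thesis unfolding K_def by simp
  qed
  have pw: "exp (- (c * norm x powr \<alpha>)) \<le> K * (\<Prod>b\<in>Basis. 1 / (1 + (x \<bullet> b)\<^sup>2))" for x :: 'a
  proof -
    have "(\<Prod>b\<in>Basis. 1 + (x \<bullet> b)\<^sup>2) \<le> (\<Prod>b\<in>(Basis::'a set). 1 + (norm x)\<^sup>2)"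
      by (intro prod_mono) (auto simp: Basis_le_norm abs_le_square_iff[symmetric])
    also have "\<dots> = (1 + (norm x)\<^sup>2) powr N"
      unfolding N_def by (simp add: powr_realpow add_pos_nonneg)
    finally have "(\<Prod>b\<in>Basis. 1 + (x \<bullet> b)\<^sup>2) * exp (- (c * norm x powr \<alpha>)) \<le> K"
      using K[of "norm x"] by (smt (verit) exp_gt_zero mult_right_mono norm_ge_zero)
    moreover have "(\<Prod>b\<in>Basis. 1 + (x \<bullet> b)\<^sup>2) > 0"
      by (intro prod_pos) (auto simp: add_pos_nonneg)
    ultimately show ?thesis by (simp add: prod_dividef field_simps)
  qed
  have "(\<integral>\<^sup>+x. ennreal (exp (- (c * norm (x::'a) powr \<alpha>))) \<partial>lborel)
      \<le> (\<integral>\<^sup>+x. ennreal K * (\<Prod>b\<in>Basis. ennreal (1 / (1 + ((x::'a) \<bullet> b)\<^sup>2))) \<partial>lborel)"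
  proof (intro nn_integral_mono)
    fix x :: 'a
    have "ennreal (exp (- (c * norm x powr \<alpha>))) \<le> ennreal (K * (\<Prod>b\<in>Basis. 1 / (1 + (x \<bullet> b)\<^sup>2)))"
      by (intro ennreal_leI pw)
    also have "\<dots> = ennreal K * (\<Prod>b\<in>Basis. ennreal (1 / (1 + (x \<bullet> b)\<^sup>2)))"
      unfolding K_def by (subst ennreal_mult) (auto intro!: prod_nonneg simp: prod_ennreal)
    finally show "ennreal (exp (- (c * norm x powr \<alpha>)))
        \<le> ennreal K * (\<Prod>b\<in>Basis. ennreal (1 / (1 + (x \<bullet> b)\<^sup>2)))" .
  qed
  also have "\<dots> = ennreal K * (\<Prod>b\<in>(Basis::'a set). (\<integral>\<^sup>+x. ennreal (1 / (1 + x\<^sup>2)) \<partial>lborel))"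
    by (subst nn_integral_cmult) (auto simp: nn_integral_lborel_prod[where f="\<lambda>_ x. ennreal (1 / (1 + x\<^sup>2))"] simp del: prod_constant)
  also have "\<dots> < \<infinity>"
    using nn_integral_inverse_one_plus_square
    by (auto simp: ennreal_mult_less_top power_less_top_ennreal)
  finally show ?thesis .
qed

text \<open>Substituting x = r y with q r^\<alpha> = 1 removes q from the exponent. The Jacobian r^d
  is the source of the exponent -d/\<alpha> in the final criterion.\<close>

lemma nn_integral_exp_neg_norm_powr_scale:
  assumes "\<alpha> > 0" "q > 0"
  shows "(\<integral>\<^sup>+x. ennreal (exp (- (q * (c * norm (x::'a::euclidean_space) powr \<alpha>)))) \<partial>lborel)
    = ennreal (q powr (- real DIM('a) / \<alpha>)) * (\<integral>\<^sup>+x. ennreal (exp (- (c * norm (x::'a) powr \<alpha>))) \<partial>lborel)"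
proof -
  define r where "r = q powr (- 1 / \<alpha>)"
  have r: "r > 0" using assms unfolding r_def by simp
  have "r powr \<alpha> = q powr (- 1)" using assms by (simp add: r_def powr_powr)
  then have qr: "q * r powr \<alpha> = 1" using assms by (simp add: powr_minus)
  have sc: "q * (c * norm (r *\<^sub>R x) powr \<alpha>) = c * norm x powr \<alpha>" for x :: 'a
  proof -
    have "q * (c * norm (r *\<^sub>R x) powr \<alpha>) = (q * r powr \<alpha>) * (c * norm x powr \<alpha>)"
      using r by (simp add: powr_mult mult_ac)
    then show ?thesis by (simp add: qr)
  qed
  have rd: "\<bar>r\<bar> ^ DIM('a) = q powr (- real DIM('a) / \<alpha>)"
    using assms r by (simp add: powr_realpow[symmetric]) (simp add: r_def powr_powr)
  show ?thesis
  proof (subst nn_integral_lborel_scale[of _ r])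
    show "(\<lambda>x::'a. ennreal (exp (- (q * (c * norm x powr \<alpha>))))) \<in> borel_measurable borel"
      by measurable
    show "r \<noteq> 0" using r by simp
  qed (simp only: sc rd)
qed

section \<open>Pairs of points of a compact set\<close>

text \<open>For small \<open>z\<close> both \<open>E\<close> and its translate lie in an open set of measure at most \<open>3/2 \<lambda>(E)\<close>.\<close>

lemma measure_Int_translate_ge:
  fixes E :: "'a::euclidean_space set"
  assumes E: "compact E" and pos: "emeasure lborel E > 0"
  shows "\<exists>e>0. \<forall>z. norm z \<le> e \<longrightarrow>
    ennreal (measure lborel E / 2) \<le> emeasure lborel {x \<in> E. x + z \<in> E}"
proof -
  define m where "m = measure lborel E"
  have Ef: "emeasure lborel E < \<infinity>" by (intro emeasure_bounded_finite compact_imp_bounded E)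
  have Em[measurable]: "E \<in> sets borel" using E by (simp add: borel_compact)
  have m: "emeasure lborel E = ennreal m"
    unfolding m_def using Ef by (intro emeasure_eq_ennreal_measure) auto
  have m0: "m > 0" using pos unfolding m by simp
  obtain U where U: "open U" "E \<subseteq> U" "emeasure lborel (U - E) < ennreal (m / 2)"
    using outer_regular_lborel[of E "m / 2"] m0 by auto
  obtain e where e: "e > 0" "\<And>x y. x \<in> E \<Longrightarrow> dist y x \<le> e \<Longrightarrow> y \<in> U"
  proof -
    obtain e where e: "e > 0" "(\<Union>x\<in>E. cball x e) \<subseteq> U"
      by (rule compact_subset_open_imp_cball_epsilon_subset[OF E U(1,2)])
    have "y \<in> U" if "x \<in> E" "dist y x \<le> e" for x y
    proof -
      have "y \<in> cball x e" using that(2) by (simp add: dist_commute)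
      then show ?thesis using e(2) that(1) by blast
    qed
    then show ?thesis using that e(1) by blast
  qed
  have "ennreal (m / 2) \<le> emeasure lborel {x \<in> E. x + z \<in> E}" if z: "norm z \<le> e" for z
  proof -
    define D where "D = {x \<in> E. x + z \<in> E}"
    have De: "D = E \<inter> ((+) z -` E \<inter> space lborel)" unfolding D_def by (auto simp: add.commute)
    have Dm[measurable]: "D \<in> sets borel" unfolding De by measurable
    define T where "T = (+) z -` E \<inter> space lborel"
    have Tm[measurable]: "T \<in> sets borel" unfolding T_def by measurable
    have T: "emeasure lborel T = ennreal m"
      unfolding T_def m[symmetric]
      by (subst (2) lborel_distr_plus[of z, symmetric]) (simp add: emeasure_distr)
    \<comment> \<open>\<open>T\<close> is the translate of \<open>E\<close> by -z. A point of it
      outside \<open>E\<close> is still within \<bar>z\<bar> of \<open>E\<close>, hence in the thin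
      layer \<open>U - E\<close>, so at least half of the measure of \<open>T\<close> stays in
      \<open>D\<close>.\<close>
    have "T - D \<subseteq> U - E"
    proof
      fix x assume x: "x \<in> T - D"
      then have "z + x \<in> E" "x \<notin> E" unfolding T_def De by auto
      moreover have "dist x (z + x) \<le> e" using z by (simp add: dist_norm)
      ultimately show "x \<in> U - E" using e(2) by auto
    qed
    then have "emeasure lborel (T - D) \<le> ennreal (m / 2)"
      using U by (intro order_trans[OF emeasure_mono less_imp_le[OF U(3)]]) auto
    moreover have "emeasure lborel T \<le> emeasure lborel D + emeasure lborel (T - D)"
      by (rule order_trans[OF emeasure_mono emeasure_subadditive]) auto
    ultimately have "ennreal m \<le> emeasure lborel D + ennreal (m / 2)"
      unfolding T by (meson add_left_mono order_trans)
    moreover have "ennreal m = ennreal (m / 2) + ennreal (m / 2)"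
      using m0 by (subst ennreal_plus[symmetric]) auto
    ultimately show ?thesis unfolding D_def[symmetric] by simp
  qed
  then show ?thesis using e(1) unfolding m_def by blast
qed

text \<open>In the coordinates x and z = y - x, the measure of the close pairs is the integral over
  \<bar>z\<bar> <= r of the measure of the overlap of \<open>E\<close> with its translate by -z, and
  each overlap has at least half the measure of \<open>E\<close>.\<close>

lemma measure_close_pairs_ge:
  fixes E :: "'a::euclidean_space set"
  assumes E: "compact E" and pos: "emeasure lborel E > 0"
  defines "\<mu> \<equiv> restrict_space lborel E"
  shows "\<exists>e>0. \<forall>r. 0 \<le> r \<longrightarrow> r \<le> e \<longrightarrow>
    measure lborel E / 2 * unit_ball_vol DIM('a) * r ^ DIM('a)
      \<le> measure (\<mu> \<Otimes>\<^sub>M \<mu>) {z \<in> space (\<mu> \<Otimes>\<^sub>M \<mu>). norm (fst z - snd z) \<le> r}"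
proof -
  have Ef: "emeasure lborel E < \<infinity>" by (intro emeasure_bounded_finite compact_imp_bounded E)
  have Em[measurable]: "E \<in> sets borel" using E by (simp add: borel_compact)
  interpret M: finite_measure \<mu>
    unfolding \<mu>_def by standard (use Ef in \<open>simp add: emeasure_restrict_space space_restrict_space\<close>)
  interpret pair_sigma_finite \<mu> \<mu> ..
  interpret P: finite_measure "\<mu> \<Otimes>\<^sub>M \<mu>" by (rule finite_measure_pair_measure) unfold_locales
  have id[measurable]: "(\<lambda>x. x) \<in> \<mu> \<rightarrow>\<^sub>M borel"
    unfolding \<mu>_def by (rule measurable_restrict_space1) simp
  obtain e where e: "e > 0"
    "\<And>z. norm z \<le> e \<Longrightarrow> ennreal (measure lborel E / 2) \<le> emeasure lborel {x \<in> E. x + z \<in> E}"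
    using measure_Int_translate_ge[OF E pos] by blast
  have "measure lborel E / 2 * unit_ball_vol DIM('a) * r ^ DIM('a)
      \<le> measure (\<mu> \<Otimes>\<^sub>M \<mu>) {z \<in> space (\<mu> \<Otimes>\<^sub>M \<mu>). norm (fst z - snd z) \<le> r}"
    (is "_ \<le> measure _ ?A") if r: "0 \<le> r" "r \<le> e" for r
  proof -
    have cb[measurable]: "cball (0::'a) r \<in> sets borel" by simp
    have Am: "?A \<in> sets (\<mu> \<Otimes>\<^sub>M \<mu>)" by measurable
    let ?i = "\<lambda>x z. indicator E x * indicator E (x + z) * indicator (cball 0 r) z :: ennreal"
    have "ennreal (measure lborel E / 2 * unit_ball_vol DIM('a) * r ^ DIM('a))
        = ennreal (measure lborel E / 2) * emeasure lborel (cball (0::'a) r)"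
      unfolding emeasure_cball[OF r(1)] mult.assoc by (rule ennreal_mult) (use r in auto)
    also have "\<dots> = (\<integral>\<^sup>+z. ennreal (measure lborel E / 2) * indicator (cball (0::'a) r) z \<partial>lborel)"
      by (simp add: nn_integral_cmult_indicator)
    also have "\<dots> \<le> (\<integral>\<^sup>+z. (\<integral>\<^sup>+x. ?i x z \<partial>lborel) \<partial>lborel)"
    proof (intro nn_integral_mono)
      fix z :: 'a
      have De: "{x \<in> E. x + z \<in> E} = E \<inter> ((\<lambda>x. x + z) -` E \<inter> space lborel)" by auto
      have Dm[measurable]: "{x \<in> E. x + z \<in> E} \<in> sets borel" unfolding De by measurable
      have "(\<integral>\<^sup>+x. ?i x z \<partial>lborel)
          = (\<integral>\<^sup>+x. indicator {x \<in> E. x + z \<in> E} x * indicator (cball 0 r) z \<partial>lborel)"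
        by (intro nn_integral_cong) (auto simp: indicator_def)
      also have "\<dots> = emeasure lborel {x \<in> E. x + z \<in> E} * indicator (cball 0 r) z"
        by (subst nn_integral_multc) auto
      finally show "ennreal (measure lborel E / 2) * indicator (cball 0 r) z \<le> (\<integral>\<^sup>+x. ?i x z \<partial>lborel)"
        using e(2)[of z] r by (auto simp: indicator_def)
    qed
    also have "\<dots> = (\<integral>\<^sup>+x. (\<integral>\<^sup>+z. ?i x z \<partial>lborel) \<partial>lborel)"
      by (rule lborel_pair.Fubini') measurable
    also have "\<dots> = (\<integral>\<^sup>+x. indicator E x * (\<integral>\<^sup>+y. indicator E y * indicator (cball 0 r) (y - x) \<partial>lborel) \<partial>lborel)"
    proof (intro nn_integral_cong)
      fix x :: 'a
      have "(\<integral>\<^sup>+z. ?i x z \<partial>lborel)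
          = indicator E x * (\<integral>\<^sup>+z. indicator E (x + z) * indicator (cball 0 r) ((x + z) - x) \<partial>lborel)"
        by (subst nn_integral_cmult[symmetric]) (auto simp: mult.assoc)
      also have "(\<integral>\<^sup>+z. indicator E (x + z) * indicator (cball 0 r) ((x + z) - x) \<partial>lborel)
          = (\<integral>\<^sup>+y. indicator E y * indicator (cball 0 r) (y - x) \<partial>lborel)"
        by (rule nn_integral_lborel_shift) measurable
      finally show "(\<integral>\<^sup>+z. ?i x z \<partial>lborel)
          = indicator E x * (\<integral>\<^sup>+y. indicator E y * indicator (cball 0 r) (y - x) \<partial>lborel)" .
    qed
    also have "\<dots> = (\<integral>\<^sup>+x. (\<integral>\<^sup>+y. indicator ?A (x, y) \<partial>\<mu>) \<partial>\<mu>)"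
      unfolding \<mu>_def
      by (auto simp: nn_integral_restrict_space space_pair_measure space_restrict_space
          indicator_def norm_minus_commute intro!: nn_integral_cong)
    also have "\<dots> = emeasure (\<mu> \<Otimes>\<^sub>M \<mu>) ?A"
      using M.nn_integral_fst[of "indicator ?A" \<mu>] Am by simp
    also have "\<dots> = ennreal (measure (\<mu> \<Otimes>\<^sub>M \<mu>) ?A)"
      by (rule P.emeasure_eq_measure)
    finally show ?thesis by simp
  qed
  then show ?thesis using e(1) by blast
qed

text \<open>For fixed x the inner integral is enlarged from \<open>E\<close> to the whole space,
  where reflection and translation invariance remove x.\<close>

lemma nn_integral_pair_difference_le:
  fixes E :: "'a::euclidean_space set" and g :: "'a \<Rightarrow> ennreal"
  assumes E: "compact E" and g[measurable]: "g \<in> borel_measurable borel"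
  defines "\<mu> \<equiv> restrict_space lborel E"
  shows "(\<integral>\<^sup>+z. g (fst z - snd z) \<partial>(\<mu> \<Otimes>\<^sub>M \<mu>)) \<le> emeasure lborel E * (\<integral>\<^sup>+x. g x \<partial>lborel)"
proof -
  have Ef: "emeasure lborel E < \<infinity>" by (intro emeasure_bounded_finite compact_imp_bounded E)
  have Em[measurable]: "E \<in> sets borel" using E by (simp add: borel_compact)
  interpret M: finite_measure \<mu>
    unfolding \<mu>_def by standard (use Ef in \<open>simp add: emeasure_restrict_space space_restrict_space\<close>)
  have id[measurable]: "(\<lambda>x. x) \<in> \<mu> \<rightarrow>\<^sub>M borel"
    unfolding \<mu>_def by (rule measurable_restrict_space1) simp
  have "(\<integral>\<^sup>+z. g (fst z - snd z) \<partial>(\<mu> \<Otimes>\<^sub>M \<mu>)) = (\<integral>\<^sup>+x. (\<integral>\<^sup>+y. g (x - y) \<partial>\<mu>) \<partial>\<mu>)"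
    by (subst M.nn_integral_fst[symmetric]) auto
  also have "\<dots> \<le> (\<integral>\<^sup>+x. (\<integral>\<^sup>+y. g y \<partial>lborel) \<partial>\<mu>)"
  proof (intro nn_integral_mono)
    fix x
    have "(\<integral>\<^sup>+y. g (x - y) \<partial>\<mu>) \<le> (\<integral>\<^sup>+y. g (x - y) \<partial>lborel)"
      unfolding \<mu>_def
      by (subst nn_integral_restrict_space) (auto intro!: nn_integral_mono simp: indicator_def)
    then show "(\<integral>\<^sup>+y. g (x - y) \<partial>\<mu>) \<le> (\<integral>\<^sup>+y. g y \<partial>lborel)"
      by (simp add: nn_integral_lborel_reflect)
  qed
  also have "\<dots> = emeasure lborel E * (\<integral>\<^sup>+x. g x \<partial>lborel)"
    unfolding \<mu>_def by (simp add: emeasure_restrict_space space_restrict_space mult.commute)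
  finally show ?thesis .
qed

text \<open>Upper bound: \<bar>C\<bar>^q is dominated by exp (- c q \<bar>x - y\<bar>^\<alpha>),
  which rescales. Lower bound: pairs at distance of order q^{-1/\<alpha>} contribute the right
  order, and pairs where \<open>C\<close> may be negative contribute only an exponentially small
  amount.\<close>

lemma covariance_power_integral_bounds:
  fixes C :: "'a::euclidean_space \<Rightarrow> real"
  assumes cont: "continuous_on UNIV C"
    and less: "\<And>x. x \<noteq> 0 \<Longrightarrow> \<bar>C x\<bar> < 1"
    and pos: "C2 > 0" "C3 > 0" "\<alpha> > 0" "\<epsilon> > 0"
    and near0: "\<And>x. norm x \<le> \<epsilon> \<Longrightarrow>
                  C2 * norm x powr \<alpha> \<le> 1 - C x \<and> 1 - C x \<le> C3 * norm x powr \<alpha>"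
    and E: "compact E" "emeasure lborel E > 0"
  defines "\<mu> \<equiv> restrict_space lborel E"
    and "s \<equiv> real DIM('a) / \<alpha>"
  shows "\<exists>a b N. 0 < a \<and> 0 < b \<and> (\<forall>q\<ge>N.
     a * real q powr (- s) \<le> (\<integral>z. C (fst z - snd z) ^ q \<partial>(\<mu> \<Otimes>\<^sub>M \<mu>)) \<and>
     (\<integral>z. C (fst z - snd z) ^ q \<partial>(\<mu> \<Otimes>\<^sub>M \<mu>)) \<le> b * real q powr (- s))"
proof -
  let ?P = "\<mu> \<Otimes>\<^sub>M \<mu>"
  define I where "I q = (\<integral>z. C (fst z - snd z) ^ q \<partial>?P)" for q :: nat
  define m where "m = measure lborel E"
  have Ef: "emeasure lborel E < \<infinity>" by (intro emeasure_bounded_finite compact_imp_bounded E)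
  then have m: "emeasure lborel E = ennreal m"
    unfolding m_def by (intro emeasure_eq_ennreal_measure) auto
  have m0: "m > 0" using E(2) unfolding m by simp
  have Em[measurable]: "E \<in> sets borel" using E by (simp add: borel_compact)
  interpret M: finite_measure \<mu>
    unfolding \<mu>_def by standard (use Ef in \<open>simp add: emeasure_restrict_space space_restrict_space\<close>)
  interpret pair_sigma_finite \<mu> \<mu> ..
  interpret P: finite_measure ?P by (rule finite_measure_pair_measure) unfold_locales
  have id[measurable]: "(\<lambda>x. x) \<in> \<mu> \<rightarrow>\<^sub>M borel"
    unfolding \<mu>_def by (rule measurable_restrict_space1) simp
  have Cm[measurable]: "C \<in> borel_measurable borel"
    using cont by (rule borel_measurable_continuous_onI)
  have spP: "space ?P = E \<times> E"
    unfolding \<mu>_def by (simp add: space_pair_measure space_restrict_space)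
  obtain K where K: "\<And>x. x \<in> E \<Longrightarrow> norm x \<le> K"
    using compact_imp_bounded[OF E(1)] unfolding bounded_iff by blast
  define R where "R = 2 * \<bar>K\<bar> + 1"
  have R0: "R > 0" unfolding R_def by simp
  have R: "norm (fst z - snd z) \<le> R" if "z \<in> space ?P" for z
  proof -
    have "norm (fst z) \<le> K" "norm (snd z) \<le> K" using that K unfolding spP by auto
    then show ?thesis unfolding R_def using norm_triangle_ineq4[of "fst z" "snd z"] by linarith
  qed
  obtain c e where c: "c > 0" and e: "e > 0"
    and near: "\<And>x. norm x \<le> e \<Longrightarrow> 0 \<le> C x \<and> 1 - C3 * norm x powr \<alpha> \<le> C x"
    and far: "\<And>x. norm x \<le> R \<Longrightarrow> \<bar>C x\<bar> \<le> 1 - c * norm x powr \<alpha>"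
    using covariance_bounds[OF cont less pos near0 R0] by blast
  have C1: "\<bar>C (fst z - snd z)\<bar> \<le> 1" if "z \<in> space ?P" for z
    using far[OF R[OF that]] c by (smt (verit) mult_nonneg_nonneg powr_ge_zero)
  have int: "integrable ?P (\<lambda>z. C (fst z - snd z) ^ q)" for q
  proof (rule P.integrable_const_bound[where B = 1])
    show "AE z in ?P. norm (C (fst z - snd z) ^ q) \<le> 1"
    proof (rule AE_I2)
      fix z assume "z \<in> space ?P"
      from C1[OF this] show "norm (C (fst z - snd z) ^ q) \<le> 1"
        by (simp add: power_abs power_le_one)
    qed
  qed measurable

  obtain j where j: "j \<ge> 0"
    "(\<integral>\<^sup>+x. ennreal (exp (- (c * norm (x::'a) powr \<alpha>))) \<partial>lborel) = ennreal j"
    using nn_integral_exp_neg_norm_powr_finite[OF c pos(3), where 'a = 'a]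
    by (auto simp: less_top_ennreal)
  \<comment> \<open>The added 1 makes the constant strictly positive, as only \<open>j >= 0\<close>
    is recorded.\<close>
  have upper: "I q \<le> (m * j + 1) * real q powr (- s)" if q: "q > 0" for q
  proof -
    have "ennreal (norm (I q)) \<le> (\<integral>\<^sup>+z. ennreal (norm (C (fst z - snd z) ^ q)) \<partial>?P)"
      unfolding I_def by (rule integral_norm_bound_ennreal[OF int])
    also have "\<dots> \<le> (\<integral>\<^sup>+z. ennreal (exp (- (real q * (c * norm (fst z - snd z) powr \<alpha>)))) \<partial>?P)"
    proof (intro nn_integral_mono ennreal_leI)
      fix z assume z: "z \<in> space ?P"
      have "\<bar>C (fst z - snd z)\<bar> \<le> exp (- (c * norm (fst z - snd z) powr \<alpha>))"
        using far[OF R[OF z]] exp_ge_add_one_self[of "- (c * norm (fst z - snd z) powr \<alpha>)"] by linarith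
      then have "\<bar>C (fst z - snd z)\<bar> ^ q \<le> exp (- (c * norm (fst z - snd z) powr \<alpha>)) ^ q"
        by (rule power_mono) simp
      then show "norm (C (fst z - snd z) ^ q) \<le> exp (- (real q * (c * norm (fst z - snd z) powr \<alpha>)))"
        by (simp add: power_abs exp_of_nat_mult[symmetric])
    qed
    also have "\<dots> \<le> emeasure lborel E
        * (\<integral>\<^sup>+x. ennreal (exp (- (real q * (c * norm (x::'a) powr \<alpha>)))) \<partial>lborel)"
      unfolding \<mu>_def by (rule nn_integral_pair_difference_le[OF E(1)]) measurable
    also have "\<dots> = ennreal (m * (real q powr (- s) * j))"
      using q m0 j(1) unfolding s_def m
      by (subst nn_integral_exp_neg_norm_powr_scale[OF pos(3)])
        (auto simp: j(2) ennreal_mult[symmetric])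
    finally have "norm (I q) \<le> m * (real q powr (- s) * j)"
      using m0 j(1) by (subst (asm) ennreal_le_iff) auto
    then have "I q \<le> m * j * real q powr (- s)" by (simp add: mult_ac)
    moreover have "0 \<le> real q powr (- s)" by simp
    ultimately show ?thesis unfolding distrib_right by linarith
  qed

  \<comment> \<open>Bounds \<bar>C\<bar> on differences of norm greater than \<open>e\<close>; the
    1/2 keeps it positive so that its logarithm can be taken.\<close>
  define \<rho> where "\<rho> = max (1 / 2) (1 - c * e powr \<alpha>)"
  have \<rho>: "0 < \<rho>" "\<rho> < 1" using c e unfolding \<rho>_def by auto
  have mP: "measure ?P (space ?P) = m\<^sup>2"
  proof -
    have "emeasure ?P (E \<times> E) = emeasure \<mu> E * emeasure \<mu> E"
      by (rule M.emeasure_pair_measure_Times) (auto simp: \<mu>_def sets_restrict_space)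
    also have "emeasure \<mu> E = ennreal m" unfolding \<mu>_def m[symmetric] by (simp add: emeasure_restrict_space)
    finally show ?thesis
      unfolding spP measure_def using m0 by (simp add: ennreal_mult[symmetric] power2_eq_square)
  qed
  obtain e' where e': "e' > 0"
    "\<And>r. 0 \<le> r \<Longrightarrow> r \<le> e' \<Longrightarrow> m / 2 * unit_ball_vol DIM('a) * r ^ DIM('a)
      \<le> measure ?P {z \<in> space ?P. norm (fst z - snd z) \<le> r}"
    using measure_close_pairs_ge[OF E] unfolding m_def \<mu>_def by blast
  \<comment> \<open>Chosen so that C3 r^\<alpha> = 1 / (2 q): within this distance C^q >= (1 - 1 /
    (2 q))^q >= 1/2 by the Bernoulli inequality.\<close>
  define r where "r q = (1 / (2 * C3 * real q)) powr (1 / \<alpha>)" for q :: nat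
  \<comment> \<open>The 4 combines the Bernoulli 1/2 with the 1/2 from the overlap of translates;
    the first factor comes from the d-th power of \<open>r q\<close>.\<close>
  define k where "k = (2 * C3) powr (- s) * m * unit_ball_vol DIM('a) / 4"
  have k: "k > 0" unfolding k_def using pos m0 by simp
  have lower: "k * real q powr (- s) - \<rho> ^ q * m\<^sup>2 \<le> I q"
    if q: "q > 0" "r q \<le> e" "r q \<le> e'" for q
  proof -
    let ?A = "{z \<in> space ?P. norm (fst z - snd z) \<le> r q}"
    have Am[measurable]: "?A \<in> sets ?P" by measurable
    have r0: "r q \<ge> 0" unfolding r_def by simp
    have ra: "r q powr \<alpha> = 1 / (2 * C3 * real q)"
      using pos q unfolding r_def by (simp add: powr_powr)
    \<comment> \<open>Three zones: C^q >= 1/2 up to \<open>r q\<close>, C^q >= 0 up to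
      \<open>e\<close>, and C^q >= - \<rho>^q beyond.\<close>
    have pw: "1 / 2 * indicator ?A z - \<rho> ^ q \<le> C (fst z - snd z) ^ q" if z: "z \<in> space ?P" for z
    proof -
      define d where "d = fst z - snd z"
      consider "norm d \<le> r q" | "norm d > r q" "norm d \<le> e" | "norm d > e" by linarith
      then show ?thesis
      proof cases
        case 1
        have "C3 * norm d powr \<alpha> \<le> C3 * r q powr \<alpha>"
          using 1 pos by (intro mult_left_mono powr_mono2) auto
        also have "\<dots> = 1 / (2 * real q)" using pos unfolding ra by simp
        finally have "1 - 1 / (2 * real q) \<le> C d" using near[of d] 1 q by auto
        then have "(1 - 1 / (2 * real q)) ^ q \<le> C d ^ q"
          using q by (intro power_mono) (auto simp: field_simps)
        moreover have "1 / 2 \<le> (1 - 1 / (2 * real q)) ^ q"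
        proof -
          have "1 + real q * (- (1 / (2 * real q))) \<le> (1 + - (1 / (2 * real q))) ^ q"
            by (rule Bernoulli_inequality) (use q in \<open>auto simp: field_simps\<close>)
          then show ?thesis using q by simp
        qed
        moreover have "0 \<le> \<rho> ^ q" using \<rho> by simp
        ultimately show ?thesis using 1 z unfolding d_def by simp
      next
        case 2
        then have "0 \<le> C d ^ q" using near[of d] by simp
        moreover have "0 \<le> \<rho> ^ q" using \<rho> by simp
        ultimately show ?thesis using 2 unfolding d_def by simp
      next
        case 3
        have "c * e powr \<alpha> \<le> c * norm d powr \<alpha>"
          using 3 c e pos by (intro mult_left_mono powr_mono2) auto
        then have "\<bar>C d\<bar> \<le> \<rho>" using far[of d] R[OF z] unfolding \<rho>_def d_def by linarith
        then have "\<bar>C d\<bar> ^ q \<le> \<rho> ^ q" by (rule power_mono) simp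
        then have "- (\<rho> ^ q) \<le> C d ^ q" by (simp add: power_abs[symmetric] abs_le_iff)
        then show ?thesis using 3 q unfolding d_def by simp
      qed
    qed
    have rD: "r q ^ DIM('a) = (2 * C3) powr (- s) * real q powr (- s)"
    proof -
      have "r q > 0" using pos q unfolding r_def by simp
      then have "r q ^ DIM('a) = r q powr real DIM('a)" by (simp add: powr_realpow)
      also have "\<dots> = (1 / (2 * C3 * real q)) powr s"
        unfolding r_def s_def by (simp add: powr_powr)
      also have "\<dots> = (2 * C3) powr (- s) * real q powr (- s)"
        using pos q by (simp add: powr_minus powr_mult powr_divide field_simps)
      finally show ?thesis .
    qed
    have "k * real q powr (- s) = 1 / 2 * (m / 2 * unit_ball_vol DIM('a) * r q ^ DIM('a))"
      unfolding k_def rD by simp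
    also have "\<dots> \<le> 1 / 2 * measure ?P ?A"
      by (intro mult_left_mono e'(2) r0 q) simp
    finally have "k * real q powr (- s) - \<rho> ^ q * m\<^sup>2 \<le> 1 / 2 * measure ?P ?A - \<rho> ^ q * m\<^sup>2"
      by simp
    also have "\<dots> = (\<integral>z. 1 / 2 * indicator ?A z - \<rho> ^ q \<partial>?P)"
      using Am by (subst Bochner_Integration.integral_diff) (auto simp: mP P.emeasure_eq_measure)
    also have "\<dots> \<le> I q"
      unfolding I_def
      by (intro integral_mono int pw)
        (auto intro!: Bochner_Integration.integrable_diff simp: P.emeasure_eq_measure)
    finally show ?thesis .
  qed
  have "((\<lambda>q::nat. 1 / (2 * C3 * real q)) \<longlongrightarrow> 0) sequentially"
    using pos by real_asymp
  then have r0: "(r \<longlongrightarrow> 0) sequentially"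
    unfolding r_def by (rule tendsto_zero_powrI[OF _ tendsto_const]) (use pos in auto)
  \<comment> \<open>The exponentially small error is eventually at most half of the main term, which
    leaves \<open>k / 2\<close>.\<close>
  define l where "l = - ln \<rho>"
  have l: "l > 0" unfolding l_def using \<rho> by simp
  have "((\<lambda>q::nat. m\<^sup>2 * (exp (- (l * real q)) * real q powr s)) \<longlongrightarrow> 0) sequentially"
    using l by real_asymp
  then have "eventually (\<lambda>q. m\<^sup>2 * (exp (- (l * real q)) * real q powr s) < k / 2) sequentially"
    by (rule order_tendstoD) (use k in simp)
  moreover have "eventually (\<lambda>q. r q < e) sequentially" "eventually (\<lambda>q. r q < e') sequentially"
    using order_tendstoD(2)[OF r0] e e'(1) by auto
  moreover have "eventually (\<lambda>q::nat. q > 0) sequentially" by (rule eventually_gt_at_top)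
  ultimately have "eventually (\<lambda>q. k / 2 * real q powr (- s) \<le> I q \<and>
      I q \<le> (m * j + 1) * real q powr (- s)) sequentially"
  proof eventually_elim
    case (elim q)
    have "\<rho> ^ q = exp (- (l * real q))"
      unfolding l_def using \<rho> by (simp add: mult.commute exp_of_nat_mult)
    then have "\<rho> ^ q * m\<^sup>2 * real q powr s \<le> k / 2" using elim by (simp add: mult_ac)
    then have "\<rho> ^ q * m\<^sup>2 \<le> k / 2 * real q powr (- s)"
      using elim by (simp add: powr_minus field_simps)
    then show ?case using lower[of q] upper[of q] elim by (simp add: field_simps)
  qed
  then obtain N where "\<And>q. q \<ge> N \<Longrightarrow> k / 2 * real q powr (- s) \<le> I q \<and>
      I q \<le> (m * j + 1) * real q powr (- s)"
    unfolding eventually_sequentially by blast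
  then show ?thesis
    using k m0 j(1) unfolding I_def
    by (intro exI[of _ "k / 2"] exI[of _ "m * j + 1"] exI[of _ N])
      (auto intro!: add_nonneg_pos)
qed

section \<open>Summability of the chaos expansion\<close>

theorem mainTheorem4:
  fixes M :: "'a measure" and B :: "real^'n \<Rightarrow> 'a \<Rightarrow> real" and C :: "real^'n \<Rightarrow> real"
    and E :: "(real^'n) set"
    and C1 C2 C3 \<alpha> \<delta> \<epsilon> :: real
  assumes field: "centered_stationary_gaussian_field M B C"
    and contC: "continuous_on UNIV C"
    and C0: "C 0 = 1"
    and pos: "C1 > 0" "C2 > 0" "C3 > 0" "\<alpha> > 0" "\<delta> > 0" "\<epsilon> > 0"
    and decay: "\<And>x. x \<noteq> 0 \<Longrightarrow> \<bar>C x\<bar> \<le> C1 * norm x powr (- \<delta>)"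
    and near0: "\<And>x. norm x \<le> \<epsilon> \<Longrightarrow>
                  C2 * norm x powr \<alpha> \<le> 1 - C x \<and> 1 - C x \<le> C3 * norm x powr \<alpha>"
    and E: "compact E" "emeasure lborel E > 0"
  shows "\<forall>(u::real) (p::nat).
           in_D_p2 p (\<lambda>x y. C (x - y)) (restrict_space lborel E) (indicator {u..})
           \<longleftrightarrow> real p < real CARD('n) / \<alpha> + 1 / 2"
proof (intro allI)
  fix u :: real and p :: nat
  define s where "s = real CARD('n) / \<alpha>"
  define I where "I q = (\<integral>z. C (fst z - snd z) ^ q \<partial>(restrict_space lborel E \<Otimes>\<^sub>M restrict_space lborel E))" for q :: nat
  define w where "w n = (hermite n u)\<^sup>2 / fact n" for n
  define v where "v = (std_normal_density u)\<^sup>2"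
  have v: "v > 0" unfolding v_def by (intro zero_less_power normal_density_pos) simp
  have w0: "w n \<ge> 0" for n unfolding w_def by simp
  have "\<exists>a b N. 0 < a \<and> 0 < b \<and> (\<forall>q\<ge>N. a * real q powr (- s) \<le> I q \<and> I q \<le> b * real q powr (- s))"
    using covariance_power_integral_bounds[OF contC covariance_abs_less_one[OF field C0 decay pos(5)]
        pos(2,3,4,6) near0 E]
    unfolding I_def s_def by simp
  then obtain a b N where ab: "0 < a" "0 < b"
    and I: "\<And>q. q \<ge> N \<Longrightarrow> a * real q powr (- s) \<le> I q \<and> I q \<le> b * real q powr (- s)"
    by blast
  define t where "t q = real q ^ p * fact q * (hermite_coeff q (indicator {u..}))\<^sup>2 * I q" for q
  \<comment> \<open>One q! of the squared coefficient cancels against the weight, and q! = q n! for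
    q = n+1 turns q^p into q^{p-1}.\<close>
  have t: "t (Suc n) = v * w n * real (Suc n) powr (real p - 1) * I (Suc n)" for n
  proof -
    have "real (Suc n) powr (real p - 1) = real (Suc n) ^ p / real (Suc n)"
      by (simp add: powr_diff powr_realpow)
    then show ?thesis
      unfolding t_def hermite_coeff_indicator_atLeast v_def w_def
      by (simp add: power2_eq_square field_simps del: of_nat_Suc)
  qed
  have "in_D_p2 p (\<lambda>x y. C (x - y)) (restrict_space lborel E) (indicator {u..}) \<longleftrightarrow> summable t"
    unfolding in_D_p2_def t_def I_def ..
  \<comment> \<open>The term q = 0, outside the coefficient formula, does not affect
    summability.\<close>
  also have "\<dots> \<longleftrightarrow> summable (\<lambda>n. t (Suc n))"
    by (rule summable_Suc_iff[symmetric])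
  also have "\<dots> \<longleftrightarrow> real p < s + 1 / 2"
  proof
    assume p: "real p < s + 1 / 2"
    obtain b' N' where b': "b' > 0"
      and w: "\<And>n. n \<ge> N' \<Longrightarrow> w (Suc n) + w n \<le> b' * real (Suc n) powr (- 1 / 2)"
      using hermite_square_sum_bounds[of u] unfolding w_def by blast
    \<comment> \<open>The exponent adds up -1/2 from \<open>w n\<close>, p - 1 from the weight and
      -s from the integral; it is below -1 exactly when p < s + 1/2. For this direction
      \<open>w n\<close> is simply bounded by the pair sum.\<close>
    have "summable (\<lambda>n. real n powr (real p - 3 / 2 - s))"
      using p by (simp add: summable_real_powr_iff)
    then have "summable (\<lambda>n. real (Suc n) powr (real p - 3 / 2 - s))"
      by (subst (asm) summable_Suc_iff[symmetric])
    then have sm: "summable (\<lambda>n. v * b' * b * real (Suc n) powr (real p - 3 / 2 - s))"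
      by (rule summable_mult)
    show "summable (\<lambda>n. t (Suc n))"
    proof (rule summable_comparison_test'[OF sm, of "max N N'"])
      fix n assume n: "n \<ge> max N N'"
      let ?x = "real (Suc n)"
      have I1: "0 \<le> I (Suc n)" "I (Suc n) \<le> b * ?x powr (- s)"
        using I[of "Suc n"] n ab by (auto intro: order_trans[rotated])
      have w1: "w n \<le> b' * ?x powr (- 1 / 2)" using w[of n] n w0[of "Suc n"] by simp
      have "norm (t (Suc n)) = v * w n * ?x powr (real p - 1) * I (Suc n)"
        unfolding t using v w0[of n] I1(1) by (simp add: abs_mult)
      also have "\<dots> \<le> v * (b' * ?x powr (- 1 / 2)) * ?x powr (real p - 1) * (b * ?x powr (- s))"
        using v b' w0[of n] w1 I1 by (intro mult_mono mult_nonneg_nonneg) auto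
      also have "\<dots> = v * b' * b * (?x powr (- 1 / 2) * ?x powr (real p - 1) * ?x powr (- s))"
        by (simp only: mult_ac)
      also have "\<dots> = v * b' * b * ?x powr (real p - 3 / 2 - s)"
        unfolding powr_add[symmetric] by (simp add: algebra_simps)
      finally show "norm (t (Suc n)) \<le> v * b' * b * ?x powr (real p - 3 / 2 - s)" .
    qed
  next
    assume sm: "summable (\<lambda>n. t (Suc n))"
    show "real p < s + 1 / 2"
    proof (rule ccontr)
      assume "\<not> real p < s + 1 / 2"
      \<comment> \<open>The boundary case p = s + 1/2 is included; larger p only increases the
        terms, so comparison with the critical series suffices.\<close>
      then have p: "- 1 / 2 \<le> real p - 1 - s" by simp
      have "summable (\<lambda>n. v * a * (w n * real (Suc n) powr (- 1 / 2)))"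
      proof (rule summable_comparison_test'[OF sm, of N])
        fix n assume n: "n \<ge> N"
        let ?x = "real (Suc n)"
        have "v * a * (w n * ?x powr (- 1 / 2)) \<le> v * a * (w n * ?x powr (real p - 1 - s))"
          using v ab w0[of n] p by (intro mult_left_mono powr_mono) auto
        also have "?x powr (real p - 1 - s) = ?x powr (real p - 1) * ?x powr (- s)"
          by (simp add: powr_add[symmetric])
        also have "v * a * (w n * (?x powr (real p - 1) * ?x powr (- s)))
            = v * w n * ?x powr (real p - 1) * (a * ?x powr (- s))"
          by (simp only: mult_ac)
        also have "\<dots> \<le> t (Suc n)"
          unfolding t using I[of "Suc n"] n v w0[of n] by (intro mult_left_mono) auto
        finally show "norm (v * a * (w n * ?x powr (- 1 / 2))) \<le> t (Suc n)"
          using v ab w0[of n] by simp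
      qed
      then have "summable (\<lambda>n. w n * real (Suc n) powr (- 1 / 2))"
        using v ab by (subst (asm) summable_cmult_iff) auto
      then show False using hermite_square_powr_not_summable[of u] unfolding w_def by blast
    qed
  qed
  finally show "in_D_p2 p (\<lambda>x y. C (x - y)) (restrict_space lborel E) (indicator {u..})
      \<longleftrightarrow> real p < real CARD('n) / \<alpha> + 1 / 2"
    unfolding s_def .
qed

end
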